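(* Consider $\min_{\mathbf{x}\in\mathbb{R}^d}F(\mathbf{x})=f(\mathbf{x})+r(\mathbf{x})$ with $f(\mathbf{x})=\mathbb{E}_\xi[f(\mathbf{x};\xi)]$, where $r:\mathbb{R}^d\to\mathbb{R}\cup\{+\infty\}$ is proper and lower-semicontinuous (possibly non-smooth, non-convex). Assume: (i) $\mathbb{E}_\xi[\nabla f(\mathbf{x};\xi)]=\nabla f(\mathbf{x})$ and $\mathbb{E}_\xi[\|\nabla f(\mathbf{x};\xi)-\nabla f(\mathbf{x})\|^2]\le\sigma^2$ for all $\mathbf{x}$, for some $\sigma>0$; (ii) $F(\mathbf{x}_0)-F(\mathbf{x}_* )\le\Delta<\infty$ for the initial point $\mathbf{x}_0$, where $\mathbf{x}_*$ is a global minimizer of $F$; (iii) $f$ is differentiable and $\|\nabla f(\mathbf{x})-\nabla f(\mathbf{y})\|\le L\|\mathbf{x}-\mathbf{y}\|$ for all $\mathbf{x},\mathbf{y}$, for some $L>0$. Let $\eta=\frac{c}{L}$ with $0<c<\frac12$, assume $\mathrm{prox}_{\eta r}[\mathbf{x}]\ne\emptyset$ for every $\mathbf{x}$, and put $c_1=\frac{2c(1-2c)+2}{c(1-2c)}$, $c_2=\frac{6-4c}{1-2c}$. Run algorithm MB-SPG (defined in the context) for $T\ge1$ iterations with mini-batch sizes $m_t=b(t+1)$, $t=0,\dots,T-1$, where $b>0$ is a constant integer. Then the output satisfies $$\mathbb{E}\big[\mathrm{dist}(0,\hat\partial F(\mathbf{x}_R))^2\big]\le\frac{c_1\sigma^2(\log(T)+1)}{bT}+\frac{c_2\Delta}{\eta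 T}.$$ In particular, to have $\mathbb{E}[\mathrm{dist}(0,\hat\partial F(\mathbf{x}_R))]\le\epsilon$ it suffices to set $T=\widetilde O(1/\epsilon^2)$, and the total complexity (total number $\sum_{t=0}^{T-1}m_t$ of stochastic gradients computed) is $\widetilde O(1/\epsilon^4)$.
   Context: Algorithm MB-SPG (mini-batch stochastic proximal gradient): starting from $\mathbf{x}_0$, for $t=0,\dots,T-1$ draw $m_t$ fresh i.i.d. samples $\xi_1,\dots,\xi_{m_t}$ of $\xi$, independent of the past, set $\mathbf{g}_t=\frac{1}{m_t}\sum_{i=1}^{m_t}\nabla f(\mathbf{x}_t;\xi_i)$, and choose $\mathbf{x}_{t+1}\in\mathrm{prox}_{\eta r}[\mathbf{x}_t-\eta\mathbf{g}_t]$ (the iterates being random variables). Output $\mathbf{x}_R$ with $R$ uniform on $\{1,\dots,T\}$, independent of everything else. $\|\cdot\|$ is the Euclidean norm; $\mathrm{prox}_{\eta r}[\mathbf{x}]=\arg\min_{\mathbf{y}\in\mathbb{R}^d}\frac{1}{2\eta}\|\mathbf{y}-\mathbf{x}\|^2+r(\mathbf{y})$ (set of minimizers). For $h:\mathbb{R}^d\to\mathbb{R}\cup\{+\infty\}$ and $\bar{\mathbf{x}}$ with $h(\bar{\mathbf{x}})$ finite, the Fréchet subgradient set is $\hat\partial h(\bar{\mathbf{x}})=\{\mathbf{v}\in\mathbb{R}^d:\liminf_{\mathbf{x}\to\bar{\mathbf{x}},\,\mathbf{x}\ne\bar{\mathbf{x}}}\frac{h(\mathbf{x})-h(\bar{\mathbf{x}})-\mathbf{v}^\top(\mathbf{x}-\bar{\mathbf{x}})}{\|\mathbf{x}-\bar{\mathbf{x}}\|}\ge0\}$.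 $\mathrm{dist}(0,S)=\inf_{\mathbf{v}\in S}\|\mathbf{v}\|$ (and $+\infty$ if $S=\emptyset$). $\widetilde O(\cdot)$ suppresses factors logarithmic in $1/\epsilon$, as $\epsilon\to0$; implicit constants depend only on $b,c,L,\Delta,\sigma$. *)

theory Defs
  imports "HOL-Probability.Probability" "HOL-Library.Landau_Symbols"
begin

text \<open>
  Extended-real-valued functions have type \<open>'a \<Rightarrow> ereal\<close>; that they avoid \<open>-\<infinity>\<close> is
  part of \<open>proper_fun\<close>.
\<close>

definition proper_fun :: "('a \<Rightarrow> ereal) \<Rightarrow> bool" where
  "proper_fun h \<longleftrightarrow> (\<forall>x. h x \<noteq> -\<infinity>) \<and> (\<exists>x. h x \<noteq> \<infinity>)"

definition lsc_fun :: "('a::topological_space \<Rightarrow> ereal) \<Rightarrow> bool" where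
  "lsc_fun h \<longleftrightarrow> (\<forall>x. h x \<le> Liminf (at x) h)"

definition prox :: "real \<Rightarrow> ('a::real_normed_vector \<Rightarrow> ereal) \<Rightarrow> 'a \<Rightarrow> 'a set" where
  "prox \<eta> r x =
     {y. is_arg_min (\<lambda>z. ereal (1 / (2 * \<eta>) * (norm (z - x))\<^sup>2) + r z) (\<lambda>_. True) y}"

text \<open>The set is empty at points where \<open>h\<close> is not finite.\<close>

definition frechet_subdiff :: "('a::real_inner \<Rightarrow> ereal) \<Rightarrow> 'a \<Rightarrow> 'a set" where
  "frechet_subdiff h x =
     {v. \<bar>h x\<bar> \<noteq> \<infinity> \<and>
         0 \<le> Liminf (at x) (\<lambda>y. (h y - h x - ereal (v \<bullet> (y - x))) / ereal (norm (y - x)))}"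

text \<open>
  The value lies in \<open>[0, \<infinity>]\<close> and is \<open>\<infinity>\<close> on the empty set. For a lower semicontinuous \<open>h\<close>
  on a Euclidean space, \<open>\<lambda>x. dist_zero (frechet_subdiff h x)\<close> is Borel measurable, so that its
  nonnegative integrals below are genuine expectations.
\<close>

definition dist_zero :: "'a::real_normed_vector set \<Rightarrow> ennreal" where
  "dist_zero S = (INF v\<in>S. ennreal (norm v))"

text \<open>
  In a run, \<open>X t\<close> is the \<open>t\<close>-th iterate and \<open>S t i\<close>, \<open>i < m t\<close>, are the samples drawn in
  iteration \<open>t\<close>. The history at time \<open>t\<close> is the sigma-algebra generated by \<open>X 0, \<dots>, X t\<close> and
  by the batches of the iterations before \<open>t\<close>; the randomness of \<open>X t\<close> may exceed that
  of the earlier batches, since the choice of a proximal point is unrestricted.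
\<close>

definition history ::
  "'w measure \<Rightarrow> 's measure \<Rightarrow> (nat \<Rightarrow> nat) \<Rightarrow> (nat \<Rightarrow> 'w \<Rightarrow> 'a::topological_space) \<Rightarrow>
   (nat \<Rightarrow> nat \<Rightarrow> 'w \<Rightarrow> 's) \<Rightarrow> nat \<Rightarrow> 'w set set" where
  "history M D m X S t = sigma_sets (space M)
     ({X s -` A \<inter> space M | s A. s \<le> t \<and> A \<in> sets borel} \<union>
      {S s i -` A \<inter> space M | s i A. s < t \<and> i < m s \<and> A \<in> sets D})"

definition batch_events ::
  "'w measure \<Rightarrow> 's measure \<Rightarrow> (nat \<Rightarrow> nat) \<Rightarrow> (nat \<Rightarrow> nat \<Rightarrow> 'w \<Rightarrow> 's) \<Rightarrow> nat \<Rightarrow> 'w set set" where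
  "batch_events M D m S t = sigma_sets (space M)
     {S t i -` A \<inter> space M | i A. i < m t \<and> A \<in> sets D}"

text \<open>
  A run of the algorithm over \<open>T\<close> iterations on the probability space \<open>M\<close>. \<open>D\<close> is the
  distribution of \<open>\<xi>\<close>, and \<open>G x \<xi>\<close> the stochastic gradient at \<open>x\<close> for the sample \<open>\<xi>\<close>.
\<close>

locale mb_spg_run = prob_space M
  for M :: "'w measure" +
  fixes D :: "'s measure"
    and G :: "'a::euclidean_space \<Rightarrow> 's \<Rightarrow> 'a"
    and r :: "'a \<Rightarrow> ereal"
    and \<eta> :: real
    and m :: "nat \<Rightarrow> nat"
    and x0 :: 'a
    and T :: nat
    and X :: "nat \<Rightarrow> 'w \<Rightarrow> 'a"
    and S :: "nat \<Rightarrow> nat \<Rightarrow> 'w \<Rightarrow> 's"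
    and R :: "'w \<Rightarrow> nat"
  assumes iterate_measurable: "t \<le> T \<Longrightarrow> X t \<in> borel_measurable M"
    and sample_distr: "t < T \<Longrightarrow> i < m t \<Longrightarrow> S t i \<in> M \<rightarrow>\<^sub>M D \<and> distr M D (S t i) = D"
    and sample_indep: "t < T \<Longrightarrow> indep_vars (\<lambda>_. D) (S t) {..<m t}"
    and batch_fresh: "t < T \<Longrightarrow> indep_set (history M D m X S t) (batch_events M D m S t)"
    and start: "\<omega> \<in> space M \<Longrightarrow> X 0 \<omega> = x0"
    and step: "t < T \<Longrightarrow> \<omega> \<in> space M \<Longrightarrow>
      X (Suc t) \<omega> \<in> prox \<eta> r (X t \<omega> - \<eta> *\<^sub>R ((1 / real (m t)) *\<^sub>R (\<Sum>i<m t. G (X t \<omega>) (S t i \<omega>))))"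
    and output_measurable: "R \<in> M \<rightarrow>\<^sub>M count_space {1..T}"
    and output_uniform: "distr M (count_space {1..T}) R = uniform_count_measure {1..T}"
    and output_indep:
      "indep_set {R -` A \<inter> space M | A. A \<subseteq> {1..T}} (history M D m X S T)"

text \<open>
  Smallest number of iterations whose guarantee on the expected squared distance is at most
  \<open>\<epsilon>\<^sup>2\<close>. It is a closed function of the listed parameters, so the constants hidden in a
  \<open>soft_O\<close> bound on it depend on nothing else, in particular neither on the dimension nor on
  the objective.
\<close>

definition iteration_count :: "nat \<Rightarrow> real \<Rightarrow> real \<Rightarrow> real \<Rightarrow> real \<Rightarrow> real \<Rightarrow> nat" where
  "iteration_count b c L \<Delta> \<sigma> \<epsilon> =
     (let \<eta> = c / L;
          c1 = (2 * c * (1 - 2 * c) + 2) / (c * (1 - 2 * c));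
          c2 = (6 - 4 * c) / (1 - 2 * c)
      in LEAST T. 1 \<le> T \<and>
           c1 * \<sigma>\<^sup>2 * (ln (real T) + 1) / (real b * real T) + c2 * \<Delta> / (\<eta> * real T) \<le> \<epsilon>\<^sup>2)"

definition soft_O :: "(real \<Rightarrow> real) \<Rightarrow> (real \<Rightarrow> real) set" where
  "soft_O g = (\<Union>p::nat. O[at_right 0](\<lambda>\<epsilon>. g \<epsilon> * ln (1 / \<epsilon>) ^ p))"

end

theory Submission
  imports Defs "HOL-Real_Asymp.Real_Asymp"
begin

text \<open>
  The optimality condition of the proximal step \<open>x' \<in> prox \<eta> r (x - \<eta> g)\<close> makes
  \<open>v = gradf x' - g - (x' - x) / \<eta>\<close> a Frechet subgradient of \<open>F\<close> at \<open>x'\<close>. Testing the minimality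
  of \<open>x'\<close> against \<open>x\<close> and using the quadratic bounds on \<open>f\<close> gives
  \<open>\<parallel>v\<parallel>\<^sup>2 \<le> c1 \<parallel>g - gradf x\<parallel>\<^sup>2 + c2 / \<eta> (F x - F x')\<close>. Summed along a run, the second term
  telescopes and is at most \<open>c2 \<Delta> / \<eta>\<close>. As the batch is independent of the current iterate, the
  expectation of the first term is at most \<open>c1 \<sigma>\<^sup>2 / m t\<close>; these contributions add up to a
  harmonic sum, whence the logarithm. Averaging over the independent uniform output index
  divides everything by \<open>T\<close>.
\<close>

section \<open>The deterministic proximal step\<close>

text \<open>On the segment from \<open>x\<close> to \<open>y\<close>, \<open>\<phi>\<close> is
  \<open>f\<close> minus its linear part and the claimed quadratic term. By Cauchy-Schwarz and the
  Lipschitz bound its derivative is at most 0 there, so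
  \<open>\<phi> 1 \<le> \<phi> 0\<close>.\<close>

lemma lipschitz_gradient_upper:
  fixes f :: "'a::real_inner \<Rightarrow> real"
  assumes grad: "\<And>x. GDERIV f x :> g x"
    and lip: "\<And>x y. norm (g x - g y) \<le> L * norm (x - y)"
  shows "f y \<le> f x + g x \<bullet> (y - x) + L / 2 * (norm (y - x))\<^sup>2"
proof -
  define h where "h = y - x"
  define \<phi> where "\<phi> s = f (x + s *\<^sub>R h) - s * (g x \<bullet> h) - L / 2 * (norm h)\<^sup>2 * s\<^sup>2" for s :: real
  have der: "(\<phi> has_real_derivative
      (h \<bullet> g (x + s *\<^sub>R h) - g x \<bullet> h - L * (norm h)\<^sup>2 * s)) (at s)" for s
  proof -
    have "((\<lambda>s. x + s *\<^sub>R h) has_derivative (\<lambda>u. u *\<^sub>R h)) (at s)"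
      by (auto intro!: derivative_eq_intros)
    moreover have "(f has_derivative (\<lambda>u. u \<bullet> g (x + s *\<^sub>R h))) (at (x + s *\<^sub>R h))"
      using grad by (simp add: gderiv_def)
    ultimately have "((\<lambda>s. f (x + s *\<^sub>R h)) has_derivative (\<lambda>u. (u *\<^sub>R h) \<bullet> g (x + s *\<^sub>R h))) (at s)"
      by (rule has_derivative_compose)
    then have "((\<lambda>s. f (x + s *\<^sub>R h)) has_real_derivative (h \<bullet> g (x + s *\<^sub>R h))) (at s)"
      by (rule has_derivative_imp_has_field_derivative) (simp add: mult.commute)
    then show ?thesis
      unfolding \<phi>_def by (auto intro!: derivative_eq_intros)
  qed
  have neg: "h \<bullet> g (x + s *\<^sub>R h) - g x \<bullet> h - L * (norm h)\<^sup>2 * s \<le> 0" if "0 \<le> s" for s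
  proof -
    have "h \<bullet> g (x + s *\<^sub>R h) - g x \<bullet> h = h \<bullet> (g (x + s *\<^sub>R h) - g x)"
      by (simp add: inner_diff_right inner_commute)
    also have "\<dots> \<le> norm h * norm (g (x + s *\<^sub>R h) - g x)"
      by (rule norm_cauchy_schwarz)
    also have "\<dots> \<le> norm h * (L * norm (x + s *\<^sub>R h - x))"
      by (intro mult_left_mono lip) simp
    also have "\<dots> = L * (norm h)\<^sup>2 * s"
      using that by (simp add: power2_eq_square)
    finally show ?thesis by simp
  qed
  have "\<phi> 1 \<le> \<phi> 0"
    using der neg by (intro DERIV_nonpos_imp_nonincreasing[where f = \<phi>]) force+
  then show ?thesis
    by (simp add: \<phi>_def h_def)
qed

lemma lipschitz_gradient_lower:
  fixes f :: "'a::real_inner \<Rightarrow> real"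
  assumes grad: "\<And>x. GDERIV f x :> g x"
    and lip: "\<And>x y. norm (g x - g y) \<le> L * norm (x - y)"
  shows "f x + g x \<bullet> (y - x) - L / 2 * (norm (y - x))\<^sup>2 \<le> f y"
proof -
  have "- f y \<le> - f x + (- g x) \<bullet> (y - x) + L / 2 * (norm (y - x))\<^sup>2"
  proof (rule lipschitz_gradient_upper[where f = "\<lambda>x. - f x" and g = "\<lambda>x. - g x"])
    show "GDERIV (\<lambda>x. - f x) x :> - g x" for x
      using grad[of x] by (auto simp: gderiv_def intro!: derivative_eq_intros)
    show "norm (- g x - - g y) \<le> L * norm (x - y)" for x y
      using lip[of x y] by (simp add: norm_minus_commute)
  qed
  then show ?thesis by simp
qed

section \<open>Frechet subgradients and proximal points\<close>

text \<open>A quadratic minorant with slope \<open>v\<close> bounds the difference quotient below by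
  \<open>- C * norm (y - x)\<close>, which tends to 0 as \<open>y\<close> tends to
  \<open>x\<close>.\<close>

lemma frechet_subdiffI:
  fixes h :: "'a::euclidean_space \<Rightarrow> ereal"
  assumes fin: "\<bar>h x\<bar> \<noteq> \<infinity>"
    and lower: "\<And>y. h x + ereal (v \<bullet> (y - x) - C * (norm (y - x))\<^sup>2) \<le> h y"
  shows "v \<in> frechet_subdiff h x"
proof -
  obtain a where a: "h x = ereal a" using fin by auto
  have "((\<lambda>y. ereal (- C * norm (y - x))) \<longlongrightarrow> ereal (- C * norm (x - x))) (at x)"
    by (intro tendsto_intros)
  then have "Liminf (at x) (\<lambda>y. ereal (- C * norm (y - x))) = 0"
    by (subst lim_imp_Liminf) (auto simp: zero_ereal_def trivial_limit_at)
  moreover have "Liminf (at x) (\<lambda>y. ereal (- C * norm (y - x)))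
      \<le> Liminf (at x) (\<lambda>y. (h y - h x - ereal (v \<bullet> (y - x))) / ereal (norm (y - x)))"
  proof (rule Liminf_mono, rule eventually_at_filter[THEN iffD2], rule always_eventually, safe)
    fix y assume "y \<noteq> x"
    then have n: "norm (y - x) > 0" by simp
    show "ereal (- C * norm (y - x)) \<le> (h y - h x - ereal (v \<bullet> (y - x))) / ereal (norm (y - x))"
    proof (cases "h y")
      case (real b)
      have "a + (v \<bullet> (y - x) - C * (norm (y - x))\<^sup>2) \<le> b"
        using lower[of y] by (simp add: a real)
      then have "- C * norm (y - x) \<le> (b - a - v \<bullet> (y - x)) / norm (y - x)"
        using n by (simp add: field_simps power2_eq_square)
      then show ?thesis using n by (simp add: a real)
    next
      case PInf
      then show ?thesis using n by (simp add: a)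
    next
      case MInf
      then show ?thesis using lower[of y] by (simp add: a)
    qed
  qed
  ultimately show ?thesis
    using fin by (simp add: frechet_subdiff_def)
qed

lemma prox_le:
  assumes "y \<in> prox \<eta> r x"
  shows "ereal (1 / (2 * \<eta>) * (norm (y - x))\<^sup>2) + r y \<le> ereal (1 / (2 * \<eta>) * (norm (z - x))\<^sup>2) + r z"
  using assms by (auto simp: prox_def is_arg_min_linorder)

lemma prox_finite:
  assumes "proper_fun r" "y \<in> prox \<eta> r x"
  shows "\<bar>r y\<bar> \<noteq> \<infinity>"
proof -
  obtain z where z: "r z \<noteq> \<infinity>" using assms by (auto simp: proper_fun_def)
  have "r y \<noteq> - \<infinity>" "r z \<noteq> - \<infinity>" using assms by (auto simp: proper_fun_def)
  with z prox_le[OF assms(2), of z] show ?thesis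
    by (cases "r y"; cases "r z") auto
qed

text \<open>Minimality of \<open>x'\<close> gives a quadratic minorant of \<open>r\<close> at
  \<open>x'\<close>, and the Lipschitz gradient gives one of \<open>f\<close>. In place of a sum
  rule for subdifferentials, the two minorants are added; hence the constant
  \<open>L / 2 + 1 / (2 * \<eta>)\<close>.\<close>

lemma prox_step_subgradient:
  fixes f :: "'a::euclidean_space \<Rightarrow> real"
  assumes grad: "\<And>x. GDERIV f x :> gradf x"
    and lip: "\<And>x y. norm (gradf x - gradf y) \<le> L * norm (x - y)"
    and "proper_fun r" "0 < \<eta>"
    and step: "x' \<in> prox \<eta> r (x - \<eta> *\<^sub>R g)"
  shows "gradf x' - g - (1 / \<eta>) *\<^sub>R (x' - x) \<in> frechet_subdiff (\<lambda>x. ereal (f x) + r x) x'"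
proof (rule frechet_subdiffI)
  obtain a where a: "r x' = ereal a"
    using prox_finite[OF \<open>proper_fun r\<close> step] by auto
  show "\<bar>ereal (f x') + r x'\<bar> \<noteq> \<infinity>" by (simp add: a)
  let ?v = "gradf x' - g - (1 / \<eta>) *\<^sub>R (x' - x)"
  fix y
  show "ereal (f x') + r x' + ereal (?v \<bullet> (y - x') - (L / 2 + 1 / (2 * \<eta>)) * (norm (y - x'))\<^sup>2)
        \<le> ereal (f y) + r y"
  proof (cases "r y")
    case (real b)
    define z where "z = x - \<eta> *\<^sub>R g"
    have 1: "1 / (2 * \<eta>) * (norm (x' - z))\<^sup>2 + a \<le> 1 / (2 * \<eta>) * (norm (y - z))\<^sup>2 + b"
      using prox_le[OF step, of y] by (simp add: a real z_def)
    have 2: "f x' + gradf x' \<bullet> (y - x') - L / 2 * (norm (y - x'))\<^sup>2 \<le> f y"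
      by (rule lipschitz_gradient_lower[OF grad lip])
    \<comment> \<open>Expanding around \<open>x'\<close> shows that the proximal term contributes
      the slope \<open>- (x' - z) / \<eta> = - g - (x' - x) / \<eta>\<close>.\<close>
    have "(norm (y - z))\<^sup>2 = (norm (x' - z))\<^sup>2 + 2 * ((x' - z) \<bullet> (y - x')) + (norm (y - x'))\<^sup>2"
      by (simp add: power2_norm_eq_inner algebra_simps inner_commute)
    then have "1 / (2 * \<eta>) * (norm (y - z))\<^sup>2 = 1 / (2 * \<eta>) * (norm (x' - z))\<^sup>2
        + 1 / \<eta> * ((x' - z) \<bullet> (y - x')) + 1 / (2 * \<eta>) * (norm (y - x'))\<^sup>2"
      using \<open>0 < \<eta>\<close> by (simp add: field_simps)
    moreover have "?v \<bullet> (y - x') = gradf x' \<bullet> (y - x') - 1 / \<eta> * ((x' - z) \<bullet> (y - x'))"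
      using \<open>0 < \<eta>\<close> by (simp add: z_def inner_diff_left inner_add_left algebra_simps)
    ultimately have "f x' + a + (?v \<bullet> (y - x') - (L / 2 + 1 / (2 * \<eta>)) * (norm (y - x'))\<^sup>2) \<le> f y + b"
      using 1 2 by (simp add: algebra_simps)
    then show ?thesis by (simp add: a real)
  next
    case PInf
    then show ?thesis by simp
  next
    case MInf
    then show ?thesis using \<open>proper_fun r\<close> by (auto simp: proper_fun_def)
  qed
qed

text \<open>
  Minimality of the proximal point against \<open>x\<close> is combined with the quadratic bound on \<open>f\<close> once
  at \<open>x'\<close>, which bounds the subgradient in terms of \<open>norm (x' - x)\<close>, and once at \<open>x\<close>, which
  (after Young's inequality on the gradient error) bounds \<open>norm (x' - x)\<close> by the decrease of the
  objective; here \<open>c < 1 / 2\<close> enters.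
\<close>

lemma prox_step_bound:
  fixes f :: "'a::euclidean_space \<Rightarrow> real"
  assumes grad: "\<And>x. GDERIV f x :> gradf x"
    and lip: "\<And>x y. norm (gradf x - gradf y) \<le> L * norm (x - y)"
    and "0 < L" "0 < c" "c < 1 / 2" "\<eta> = c / L"
    and rx: "r x = ereal a" and rx': "r x' = ereal a'"
    and step: "x' \<in> prox \<eta> r (x - \<eta> *\<^sub>R g)"
  shows "(norm (gradf x' - g - (1 / \<eta>) *\<^sub>R (x' - x)))\<^sup>2
    \<le> (2 * c * (1 - 2 * c) + 2) / (c * (1 - 2 * c)) * (norm (g - gradf x))\<^sup>2
      + (6 - 4 * c) / (1 - 2 * c) / \<eta> * ((f x + a) - (f x' + a'))"
proof -
  define d where "d = x' - x"
  define e where "e = g - gradf x"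
  define \<delta> where "\<delta> = (f x + a) - (f x' + a')"
  have \<eta>: "0 < \<eta>" and L: "L = c / \<eta>" using assms by auto
  \<comment> \<open>The competitor \<open>x\<close> is at distance
    \<open>norm (\<eta> *\<^sub>R g)\<close> from the centre of the proximal step; expanding the
    left side produces the same term, which cancels.\<close>
  have "1 / (2 * \<eta>) * (norm (d + \<eta> *\<^sub>R g))\<^sup>2 + a' \<le> 1 / (2 * \<eta>) * (norm (\<eta> *\<^sub>R g))\<^sup>2 + a"
    using prox_le[OF step, of x] by (simp add: rx rx' d_def algebra_simps)
  moreover have "1 / (2 * \<eta>) * (norm (d + \<eta> *\<^sub>R g))\<^sup>2 =
      1 / (2 * \<eta>) * (norm d)\<^sup>2 + g \<bullet> d + 1 / (2 * \<eta>) * (norm (\<eta> *\<^sub>R g))\<^sup>2"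
    unfolding power2_norm_eq_inner using \<eta>
    by (simp add: inner_add_left inner_add_right inner_commute add_divide_distrib)
  ultimately have prox: "g \<bullet> d + 1 / (2 * \<eta>) * (norm d)\<^sup>2 + a' \<le> a"
    by linarith
  have f1: "f x' \<le> f x + gradf x \<bullet> d + L / 2 * (norm d)\<^sup>2"
    unfolding d_def by (rule lipschitz_gradient_upper[OF grad lip])
  have f2: "f x' - gradf x' \<bullet> d - L / 2 * (norm d)\<^sup>2 \<le> f x"
    using lipschitz_gradient_lower[OF grad lip, of x' x]
    by (simp add: d_def inner_diff_right norm_minus_commute)
  \<comment> \<open>Young's inequality with weight \<open>L\<close>: its quadratic term and that of
    \<open>f1\<close> add up to \<open>L * (norm d)\<^sup>2\<close>, leaving the coefficient
    \<open>1 / (2 * \<eta>) - L = (1 - 2 * c) / (2 * \<eta>)\<close>, which is positive because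
    \<open>c < 1 / 2\<close>.\<close>
  have "0 \<le> (norm (e + L *\<^sub>R d))\<^sup>2" by simp
  also have "\<dots> = (norm e)\<^sup>2 + 2 * L * (e \<bullet> d) + L\<^sup>2 * (norm d)\<^sup>2"
    unfolding power2_norm_eq_inner by (simp add: algebra_simps inner_commute power2_eq_square)
  finally have young: "- (e \<bullet> d) \<le> (norm e)\<^sup>2 / (2 * L) + L / 2 * (norm d)\<^sup>2"
    using \<open>0 < L\<close> by (simp add: field_simps power2_eq_square)
  have "e \<bullet> d = g \<bullet> d - gradf x \<bullet> d" by (simp add: e_def inner_diff_left)
  then have "1 / (2 * \<eta>) * (norm d)\<^sup>2 - L * (norm d)\<^sup>2 \<le> \<delta> + (norm e)\<^sup>2 / (2 * L)"
    using prox f1 young unfolding \<delta>_def by linarith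
  then have "2 * \<eta> * (1 / (2 * \<eta>) * (norm d)\<^sup>2 - L * (norm d)\<^sup>2)
      \<le> 2 * \<eta> * (\<delta> + (norm e)\<^sup>2 / (2 * L))"
    using \<eta> by (intro mult_left_mono) auto
  then have "(1 - 2 * c) * (norm d)\<^sup>2 \<le> 2 * \<eta> * \<delta> + \<eta>\<^sup>2 * (norm e)\<^sup>2 / c"
    using \<eta> unfolding L by (simp add: algebra_simps power2_eq_square)
  then have "(1 - 2 * c) * (norm d)\<^sup>2 / \<eta>\<^sup>2 \<le> (2 * \<eta> * \<delta> + \<eta>\<^sup>2 * (norm e)\<^sup>2 / c) / \<eta>\<^sup>2"
    by (rule divide_right_mono) simp
  also have "\<dots> = 2 * \<delta> / \<eta> + (norm e)\<^sup>2 / c"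
    using \<eta> by (simp add: add_divide_distrib power2_eq_square)
  finally have dbound: "(norm d)\<^sup>2 / \<eta>\<^sup>2 \<le> (2 * \<delta> / \<eta> + (norm e)\<^sup>2 / c) / (1 - 2 * c)"
    using \<open>c < 1 / 2\<close> by (subst pos_le_divide_eq) (auto simp: mult.commute)
  have "norm (gradf x' - g) \<le> norm e + L * norm d"
  proof -
    have "gradf x' - g = (gradf x' - gradf x) - e" by (simp add: e_def)
    then have "norm (gradf x' - g) \<le> norm (gradf x' - gradf x) + norm e"
      by (metis norm_triangle_ineq4)
    then show ?thesis using lip[of x' x] by (simp add: d_def)
  qed
  then have "(norm (gradf x' - g))\<^sup>2 \<le> (norm e + L * norm d)\<^sup>2"
    by (intro power_mono) auto
  also have "\<dots> \<le> 2 * (norm e)\<^sup>2 + 2 * L\<^sup>2 * (norm d)\<^sup>2"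
    using zero_le_power2[of "norm e - L * norm d"]
    by (simp add: power2_eq_square algebra_simps)
  finally have g: "(norm (gradf x' - g))\<^sup>2 \<le> 2 * (norm e)\<^sup>2 + 2 * L\<^sup>2 * (norm d)\<^sup>2" .
  \<comment> \<open>\<open>q\<close> stands for \<open>(norm d)\<^sup>2 / \<eta>\<^sup>2\<close>,
    and \<open>K = 2 * L\<^sup>2 * (norm d)\<^sup>2\<close> equals \<open>2 * c\<^sup>2 * q\<close>
    since \<open>L = c / \<eta>\<close>; what remains is adding up coefficients of
    \<open>q\<close>.\<close>
  have collect: "X \<le> E + D + (2 * c\<^sup>2 + c) * q"
    if "X \<le> N + (D + (c - 1) * q) + q" "N \<le> E + K" "K = 2 * c\<^sup>2 * q" for X N D E K q
    using that by (simp add: algebra_simps)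
  have expand: "(norm (gradf x' - g - (1 / \<eta>) *\<^sub>R d))\<^sup>2 =
      (norm (gradf x' - g))\<^sup>2 + 2 / \<eta> * (g \<bullet> d - gradf x' \<bullet> d) + (norm d)\<^sup>2 / \<eta>\<^sup>2"
    unfolding power2_norm_eq_inner
    by (simp add: algebra_simps inner_commute power2_eq_square)
  \<comment> \<open>\<open>prox\<close> bounds \<open>g \<bullet> d\<close> and \<open>f2\<close>
    bounds \<open>- gradf x' \<bullet> d\<close>, so the cross term costs the decrease
    \<open>\<delta>\<close> and a multiple \<open>c - 1 < 0\<close> of
    \<open>(norm d)\<^sup>2 / \<eta>\<^sup>2\<close>.\<close>
  have "2 / \<eta> * (g \<bullet> d - gradf x' \<bullet> d) \<le>
      2 / \<eta> * (\<delta> + L / 2 * (norm d)\<^sup>2 - 1 / (2 * \<eta>) * (norm d)\<^sup>2)"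
    using prox f2 \<eta> unfolding \<delta>_def by (intro mult_left_mono) auto
  also have "\<dots> = 2 * \<delta> / \<eta> + (c - 1) * ((norm d)\<^sup>2 / \<eta>\<^sup>2)"
    using \<eta> unfolding L by (simp add: field_simps power2_eq_square)
  finally have "(norm (gradf x' - g - (1 / \<eta>) *\<^sub>R d))\<^sup>2
      \<le> (norm (gradf x' - g))\<^sup>2 + (2 * \<delta> / \<eta> + (c - 1) * ((norm d)\<^sup>2 / \<eta>\<^sup>2)) + (norm d)\<^sup>2 / \<eta>\<^sup>2"
    unfolding expand by simp
  then have "(norm (gradf x' - g - (1 / \<eta>) *\<^sub>R d))\<^sup>2
      \<le> 2 * (norm e)\<^sup>2 + 2 * \<delta> / \<eta> + (2 * c\<^sup>2 + c) * ((norm d)\<^sup>2 / \<eta>\<^sup>2)"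
    by (rule collect[OF _ g, THEN order_trans]) (simp_all add: L power_divide)
  \<comment> \<open>Rounding the coefficient up to 2 produces the stated constants: after inserting
    \<open>dbound\<close>, the factor of \<open>\<delta> / \<eta>\<close> is
    \<open>2 + 4 / (1 - 2 * c)\<close> and that of the squared error is
    \<open>2 + 2 / (c * (1 - 2 * c))\<close>.\<close>
  also have "\<dots> \<le> 2 * (norm e)\<^sup>2 + 2 * \<delta> / \<eta> + 2 * ((norm d)\<^sup>2 / \<eta>\<^sup>2)"
  proof -
    have "c\<^sup>2 \<le> (1/2)\<^sup>2" using assms by (intro power_mono) auto
    then have "2 * c\<^sup>2 + c \<le> 2" using \<open>c < 1/2\<close> by (simp add: power2_eq_square)
    then show ?thesis by (intro add_left_mono mult_right_mono) auto
  qed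
  also have "\<dots> \<le> 2 * (norm e)\<^sup>2 + 2 * \<delta> / \<eta> + 2 * ((2 * \<delta> / \<eta> + (norm e)\<^sup>2 / c) / (1 - 2 * c))"
    using dbound by (intro add_left_mono mult_left_mono) auto
  also have "\<dots> = (2 * c * (1 - 2 * c) + 2) / (c * (1 - 2 * c)) * (norm e)\<^sup>2 + (6 - 4 * c) / (1 - 2 * c) / \<eta> * \<delta>"
  proof -
    define k where "k = 1 - 2 * c"
    have "k \<noteq> 0" "c \<noteq> 0" "\<eta> \<noteq> 0" and six: "6 - 4 * c = 2 * k + 4"
      using assms \<eta> by (auto simp: k_def)
    then show ?thesis
      unfolding k_def[symmetric] six by (simp add: field_simps)
  qed
  finally show ?thesis by (simp add: d_def e_def \<delta>_def)
qed


section \<open>Stochastic gradients\<close>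

text \<open>The first argument is replaced by simple functions converging to the identity. As they
  take finitely many values, each composite is measurable piece by piece; continuity in the first
  argument gives convergence.\<close>

lemma borel_measurable_caratheodory:
  fixes f :: "'a::{metric_space, second_countable_topology} \<Rightarrow> 's \<Rightarrow> 'b::metric_space"
  assumes meas: "\<And>x. f x \<in> borel_measurable D"
    and cont: "\<And>\<xi>. \<xi> \<in> space D \<Longrightarrow> continuous_on UNIV (\<lambda>x. f x \<xi>)"
  shows "(\<lambda>p. f (fst p) (snd p)) \<in> borel_measurable (borel \<Otimes>\<^sub>M D)"
proof -
  have "(\<lambda>x::'a. x) \<in> borel_measurable borel" by simp
  from borel_measurable_implies_sequence_metric[OF this, of undefined] obtain s :: "nat \<Rightarrow> 'a \<Rightarrow> 'a"
    where s: "\<And>i. simple_function borel (s i)" "\<And>x. (\<lambda>i. s i x) \<longlonglongrightarrow> x"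
    by auto
  show ?thesis
  proof (rule borel_measurable_LIMSEQ_metric)
    fix i
    have fin: "finite (range (s i))"
      using simple_functionD(1)[OF s(1)[of i]] by simp
    have si: "s i \<in> borel \<rightarrow>\<^sub>M count_space (range (s i))"
      using s(1)[of i] fin by (subst measurable_count_space_eq2) (auto simp: simple_function_def)
    show "(\<lambda>p. f (s i (fst p)) (snd p)) \<in> borel_measurable (borel \<Otimes>\<^sub>M D)"
      by (rule measurable_compose_countable'[where f = "\<lambda>a p. f a (snd p)" and I = "range (s i)"])
        (use fin si meas in \<open>auto intro: measurable_compose[OF measurable_snd]
          measurable_compose[OF measurable_fst] countable_finite\<close>)
  next
    fix p :: "'a \<times> 's" assume "p \<in> space (borel \<Otimes>\<^sub>M D)"
    then have "snd p \<in> space D" by (auto simp: space_pair_measure)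
    then show "(\<lambda>i. f (s i (fst p)) (snd p)) \<longlonglongrightarrow> f (fst p) (snd p)"
      using continuous_on_tendsto_compose[OF cont[of "snd p"] s(2)[of "fst p"]] by auto
  qed
qed

text \<open>Each component of the gradient is a limit of difference quotients of \<open>f\<close>
  along a basis vector with steps \<open>t n\<close>. These are jointly measurable by the preceding
  lemma, as differentiability gives continuity in the first argument.\<close>

lemma borel_measurable_gradient:
  fixes f :: "'a::euclidean_space \<Rightarrow> 's \<Rightarrow> real"
  assumes meas: "\<And>x. f x \<in> borel_measurable D"
    and grad: "\<And>x \<xi>. \<xi> \<in> space D \<Longrightarrow> GDERIV (\<lambda>y. f y \<xi>) x :> g x \<xi>"
  shows "(\<lambda>p. g (fst p) (snd p)) \<in> borel_measurable (borel \<Otimes>\<^sub>M D)"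
proof (rule borel_measurable_euclidean_space[THEN iffD2], rule ballI)
  fix b :: 'a
  have "isCont (\<lambda>x. f x \<xi>) x" if "\<xi> \<in> space D" for x \<xi>
    using grad[OF that, of x] by (auto simp: gderiv_def dest: has_derivative_continuous)
  then have f [measurable]: "(\<lambda>p. f (fst p) (snd p)) \<in> borel_measurable (borel \<Otimes>\<^sub>M D)"
    by (intro borel_measurable_caratheodory meas) (auto simp: continuous_on_eq_continuous_at)
  have fh [measurable]: "(\<lambda>p. f (fst p + h) (snd p)) \<in> borel_measurable (borel \<Otimes>\<^sub>M D)" for h
    using measurable_compose[OF _ f, of "\<lambda>p. (fst p + h, snd p)" "borel \<Otimes>\<^sub>M D"] by simp
  define t where "t n = inverse (real (Suc n))" for n
  show "(\<lambda>p. g (fst p) (snd p) \<bullet> b) \<in> borel_measurable (borel \<Otimes>\<^sub>M D)"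
  proof (rule borel_measurable_LIMSEQ_metric)
    show "(\<lambda>p. (f (fst p + t n *\<^sub>R b) (snd p) - f (fst p) (snd p)) / t n)
        \<in> borel_measurable (borel \<Otimes>\<^sub>M D)" for n
      by measurable
  next
    fix p :: "'a \<times> 's" assume "p \<in> space (borel \<Otimes>\<^sub>M D)"
    then have "snd p \<in> space D" by (auto simp: space_pair_measure)
    then have "((\<lambda>y. f y (snd p)) has_derivative (\<lambda>u. u \<bullet> g (fst p) (snd p))) (at (fst p + 0 *\<^sub>R b))"
      using grad by (simp add: gderiv_def)
    moreover have "((\<lambda>s. fst p + s *\<^sub>R b) has_derivative (\<lambda>u. u *\<^sub>R b)) (at 0)"
      by (auto intro!: derivative_eq_intros)
    ultimately have "((\<lambda>s. f (fst p + s *\<^sub>R b) (snd p)) has_derivative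
        (\<lambda>u. (u *\<^sub>R b) \<bullet> g (fst p) (snd p))) (at 0)"
      by (rule has_derivative_compose[rotated])
    then have "((\<lambda>s. f (fst p + s *\<^sub>R b) (snd p)) has_real_derivative (g (fst p) (snd p) \<bullet> b)) (at 0)"
      by (rule has_derivative_imp_has_field_derivative) (simp add: inner_commute)
    then have "((\<lambda>h. (f (fst p + h *\<^sub>R b) (snd p) - f (fst p) (snd p)) / h) \<longlongrightarrow> g (fst p) (snd p) \<bullet> b) (at 0)"
      by (simp add: DERIV_def)
    moreover have "filterlim t (at 0) sequentially"
      unfolding t_def by (intro filterlim_atI LIMSEQ_inverse_real_of_nat) auto
    ultimately show "(\<lambda>n. (f (fst p + t n *\<^sub>R b) (snd p) - f (fst p) (snd p)) / t n)
        \<longlonglongrightarrow> g (fst p) (snd p) \<bullet> b"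
      by (rule filterlim_compose)
  qed
qed

section \<open>Independence and second moments\<close>

text \<open>Independence makes the joint law of \<open>X\<close> and \<open>Y\<close> the product of
  their laws, as is checked on rectangles; Tonelli's theorem then lets \<open>X\<close> be frozen
  while \<open>Y\<close> is averaged. This serves both for iterate against batch and for output
  index against history.\<close>

lemma (in prob_space) nn_integral_indep_sigma:
  assumes indep: "indep_set (sets A) (sets B)"
    and sp: "space A = space M" "space B = space M"
    and X: "X \<in> A \<rightarrow>\<^sub>M S" and Y: "Y \<in> B \<rightarrow>\<^sub>M T"
    and f [measurable]: "f \<in> borel_measurable (S \<Otimes>\<^sub>M T)"
  shows "(\<integral>\<^sup>+\<omega>. f (X \<omega>, Y \<omega>) \<partial>M) = (\<integral>\<^sup>+\<omega>. \<integral>\<^sup>+\<omega>'. f (X \<omega>, Y \<omega>') \<partial>M \<partial>M)"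
proof -
  have sub: "sets A \<subseteq> sets M" "sets B \<subseteq> sets M"
    using indep by (auto simp: indep_sets2_eq)
  have [measurable]: "X \<in> M \<rightarrow>\<^sub>M S" "Y \<in> M \<rightarrow>\<^sub>M T"
    using X Y measurable_mono[OF order_refl refl sub(1) sp(1)] measurable_mono[OF order_refl refl sub(2) sp(2)]
    by auto
  interpret X: prob_space "distr M S X" by (rule prob_space_distr) simp
  interpret Y: prob_space "distr M T Y" by (rule prob_space_distr) simp
  have distr: "distr M S X \<Otimes>\<^sub>M distr M T Y = distr M (S \<Otimes>\<^sub>M T) (\<lambda>\<omega>. (X \<omega>, Y \<omega>))"
  proof (rule pair_measure_eqI)
    fix U V assume "U \<in> sets (distr M S X)" "V \<in> sets (distr M T Y)"
    then have [measurable]: "U \<in> sets S" "V \<in> sets T" by auto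
    have "prob ((X -` U \<inter> space M) \<inter> (Y -` V \<inter> space M)) = prob (X -` U \<inter> space M) * prob (Y -` V \<inter> space M)"
      using measurable_sets[OF X \<open>U \<in> sets S\<close>] measurable_sets[OF Y \<open>V \<in> sets T\<close>]
      by (intro indep_setD[OF indep]) (simp_all add: sp)
    moreover have "(\<lambda>\<omega>. (X \<omega>, Y \<omega>)) -` (U \<times> V) \<inter> space M = (X -` U \<inter> space M) \<inter> (Y -` V \<inter> space M)"
      by auto
    ultimately show "emeasure (distr M S X) U * emeasure (distr M T Y) V =
        emeasure (distr M (S \<Otimes>\<^sub>M T) (\<lambda>\<omega>. (X \<omega>, Y \<omega>))) (U \<times> V)"
      by (simp add: emeasure_distr emeasure_eq_measure ennreal_mult)
  qed (simp_all add: X.sigma_finite_measure_axioms Y.sigma_finite_measure_axioms cong: sets_pair_measure_cong)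
  have "(\<integral>\<^sup>+\<omega>. f (X \<omega>, Y \<omega>) \<partial>M) = (\<integral>\<^sup>+p. f p \<partial>distr M (S \<Otimes>\<^sub>M T) (\<lambda>\<omega>. (X \<omega>, Y \<omega>)))"
    by (subst nn_integral_distr) auto
  also have "\<dots> = (\<integral>\<^sup>+p. f p \<partial>(distr M S X \<Otimes>\<^sub>M distr M T Y))"
    by (simp add: distr)
  also have "\<dots> = (\<integral>\<^sup>+x. \<integral>\<^sup>+y. f (x, y) \<partial>distr M T Y \<partial>distr M S X)"
    by (rule Y.nn_integral_fst[symmetric]) simp
  also have "\<dots> = (\<integral>\<^sup>+\<omega>. \<integral>\<^sup>+y. f (X \<omega>, y) \<partial>distr M T Y \<partial>M)"
    by (subst nn_integral_distr) auto
  also have "\<dots> = (\<integral>\<^sup>+\<omega>. \<integral>\<^sup>+\<omega>'. f (X \<omega>, Y \<omega>') \<partial>M \<partial>M)"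
    by (intro nn_integral_cong, subst nn_integral_distr)
      (auto intro!: measurable_Pair2[OF f] measurable_space[of X M S])
  finally show ?thesis .
qed

lemma (in prob_space) integrable_square_of_nn_integral:
  fixes Y :: "'a \<Rightarrow> 'b::euclidean_space"
  assumes "Y \<in> borel_measurable M" "(\<integral>\<^sup>+\<omega>. ennreal ((norm (Y \<omega>))\<^sup>2) \<partial>M) \<le> ennreal s"
  shows "integrable M (\<lambda>\<omega>. (norm (Y \<omega>))\<^sup>2)"
proof (rule integrableI_nonneg)
  show "(\<lambda>\<omega>. (norm (Y \<omega>))\<^sup>2) \<in> borel_measurable M"
    using assms(1) by measurable
  show "(\<integral>\<^sup>+\<omega>. ennreal ((norm (Y \<omega>))\<^sup>2) \<partial>M) < \<infinity>"
    by (rule le_less_trans[OF assms(2)]) simp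
qed simp

lemma (in prob_space) indep_var_inner:
  fixes X Y :: "'a \<Rightarrow> 'b::euclidean_space"
  assumes indep: "indep_var borel X borel Y"
    and int: "integrable M X" "integrable M Y"
  shows "integrable M (\<lambda>\<omega>. X \<omega> \<bullet> Y \<omega>)"
    and "(\<integral>\<omega>. X \<omega> \<bullet> Y \<omega> \<partial>M) = (\<integral>\<omega>. X \<omega> \<partial>M) \<bullet> (\<integral>\<omega>. Y \<omega> \<partial>M)"
proof -
  have ind: "indep_var borel (\<lambda>\<omega>. X \<omega> \<bullet> u) borel (\<lambda>\<omega>. Y \<omega> \<bullet> u)" for u
    using indep_var_compose[OF indep, of "\<lambda>x. x \<bullet> u" borel "\<lambda>x. x \<bullet> u" borel] by (simp add: comp_def)
  have i: "integrable M (\<lambda>\<omega>. (X \<omega> \<bullet> u) * (Y \<omega> \<bullet> u))" for u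
    by (rule indep_var_integrable[OF ind]) (use int in auto)
  then show "integrable M (\<lambda>\<omega>. X \<omega> \<bullet> Y \<omega>)"
    by (subst euclidean_inner) auto
  have "(\<integral>\<omega>. X \<omega> \<bullet> Y \<omega> \<partial>M) = (\<Sum>u\<in>Basis. \<integral>\<omega>. (X \<omega> \<bullet> u) * (Y \<omega> \<bullet> u) \<partial>M)"
    by (subst euclidean_inner) (use i in simp)
  also have "\<dots> = (\<Sum>u\<in>Basis. ((\<integral>\<omega>. X \<omega> \<partial>M) \<bullet> u) * ((\<integral>\<omega>. Y \<omega> \<partial>M) \<bullet> u))"
    by (intro sum.cong refl, subst indep_var_lebesgue_integral[OF ind]) (use int in auto)
  also have "\<dots> = (\<integral>\<omega>. X \<omega> \<partial>M) \<bullet> (\<integral>\<omega>. Y \<omega> \<partial>M)"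
    by (rule euclidean_inner[symmetric])
  finally show "(\<integral>\<omega>. X \<omega> \<bullet> Y \<omega> \<partial>M) = (\<integral>\<omega>. X \<omega> \<partial>M) \<bullet> (\<integral>\<omega>. Y \<omega> \<partial>M)" .
qed

text \<open>Variance is additive for independent centered vectors: all cross terms in the expanded
  squared norm integrate to 0, so only \<open>card I\<close> diagonal terms, each at most
  \<open>s\<close>, remain.\<close>

lemma (in prob_space) nn_integral_norm_sum_indep:
  fixes Y :: "'i \<Rightarrow> 'a \<Rightarrow> 'b::euclidean_space"
  assumes fin: "finite I" and indep: "indep_vars (\<lambda>_. borel) Y I"
    and int: "\<And>i. i \<in> I \<Longrightarrow> integrable M (Y i)"
    and centered: "\<And>i. i \<in> I \<Longrightarrow> (\<integral>\<omega>. Y i \<omega> \<partial>M) = 0"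
    and var: "\<And>i. i \<in> I \<Longrightarrow> (\<integral>\<^sup>+\<omega>. ennreal ((norm (Y i \<omega>))\<^sup>2) \<partial>M) \<le> ennreal s"
    and "0 \<le> s"
  shows "(\<integral>\<^sup>+\<omega>. ennreal ((norm (\<Sum>i\<in>I. Y i \<omega>))\<^sup>2) \<partial>M) \<le> ennreal (real (card I) * s)"
proof -
  have sq: "integrable M (\<lambda>\<omega>. (norm (Y i \<omega>))\<^sup>2)" if "i \<in> I" for i
    using int[OF that] by (intro integrable_square_of_nn_integral[OF _ var[OF that]]) auto
  have diag: "(\<integral>\<omega>. Y i \<omega> \<bullet> Y i \<omega> \<partial>M) \<le> s" if "i \<in> I" for i
    using var[OF that] \<open>0 \<le> s\<close> unfolding power2_norm_eq_inner[symmetric]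
    by (subst (asm) nn_integral_eq_integral) (use sq[OF that] in auto)
  have ind: "indep_var borel (Y i) borel (Y j)" if "i \<in> I" "j \<in> I" "i \<noteq> j" for i j
  proof -
    have "indep_var borel ((\<lambda>f. f i) \<circ> (\<lambda>\<omega>. restrict (\<lambda>i. Y i \<omega>) {i}))
        borel ((\<lambda>f. f j) \<circ> (\<lambda>\<omega>. restrict (\<lambda>i. Y i \<omega>) {j}))"
      using that by (intro indep_var_compose[OF indep_var_restrict[OF indep]]) auto
    then show ?thesis by (simp add: comp_def)
  qed
  have off: "integrable M (\<lambda>\<omega>. Y i \<omega> \<bullet> Y j \<omega>)"
      "i \<noteq> j \<Longrightarrow> (\<integral>\<omega>. Y i \<omega> \<bullet> Y j \<omega> \<partial>M) = 0" if "i \<in> I" "j \<in> I" for i j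
    using indep_var_inner[OF ind[OF that] int[OF that(1)] int[OF that(2)]] centered sq[OF that(1)] that
    by (cases "i = j"; simp add: power2_norm_eq_inner)+
  have expand: "(norm (\<Sum>i\<in>I. Y i \<omega>))\<^sup>2 = (\<Sum>i\<in>I. \<Sum>j\<in>I. Y i \<omega> \<bullet> Y j \<omega>)" for \<omega>
    by (simp add: power2_norm_eq_inner inner_sum_left inner_sum_right) (rule sum.swap)
  have "(\<integral>\<omega>. (norm (\<Sum>i\<in>I. Y i \<omega>))\<^sup>2 \<partial>M) = (\<Sum>i\<in>I. \<Sum>j\<in>I. \<integral>\<omega>. Y i \<omega> \<bullet> Y j \<omega> \<partial>M)"
    unfolding expand using off(1) by simp
  also have "\<dots> = (\<Sum>i\<in>I. \<integral>\<omega>. Y i \<omega> \<bullet> Y i \<omega> \<partial>M)"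
  proof (rule sum.cong[OF refl])
    fix i assume "i \<in> I"
    then have "(\<Sum>j\<in>I. \<integral>\<omega>. Y i \<omega> \<bullet> Y j \<omega> \<partial>M) = (\<Sum>j\<in>{i}. \<integral>\<omega>. Y i \<omega> \<bullet> Y j \<omega> \<partial>M)"
      using fin off(2) by (intro sum.mono_neutral_right) auto
    then show "(\<Sum>j\<in>I. \<integral>\<omega>. Y i \<omega> \<bullet> Y j \<omega> \<partial>M) = (\<integral>\<omega>. Y i \<omega> \<bullet> Y i \<omega> \<partial>M)" by simp
  qed
  also have "\<dots> \<le> real (card I) * s"
    using sum_mono[OF diag] by simp
  finally have "(\<integral>\<omega>. (norm (\<Sum>i\<in>I. Y i \<omega>))\<^sup>2 \<partial>M) \<le> real (card I) * s" .
  moreover have "integrable M (\<lambda>\<omega>. (norm (\<Sum>i\<in>I. Y i \<omega>))\<^sup>2)"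
    unfolding expand using off(1) by simp
  ultimately show ?thesis
    by (subst nn_integral_eq_integral) (auto intro: ennreal_leI)
qed


section \<open>Runs of the algorithm\<close>

lemma sets_sigma_sigma_sets:
  "A \<subseteq> Pow \<Omega> \<Longrightarrow> sets (sigma \<Omega> (sigma_sets \<Omega> A)) = sigma_sets \<Omega> A"
  by (subst sets_measure_of) (auto dest: sigma_sets_into_sp simp: sigma_sets_sigma_sets_eq)

context mb_spg_run
begin

definition history_algebra :: "nat \<Rightarrow> 'w measure" where
  "history_algebra t = sigma (space M) (history M D m X S t)"

definition batch_algebra :: "nat \<Rightarrow> 'w measure" where
  "batch_algebra t = sigma (space M) (batch_events M D m S t)"

lemma sets_history_algebra: "sets (history_algebra t) = history M D m X S t"
  unfolding history_algebra_def history_def by (rule sets_sigma_sigma_sets) blast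

lemma sets_batch_algebra: "sets (batch_algebra t) = batch_events M D m S t"
  unfolding batch_algebra_def batch_events_def by (rule sets_sigma_sigma_sets) blast

lemma space_history_algebra [simp]: "space (history_algebra t) = space M"
  by (simp add: history_algebra_def space_measure_of_conv)

lemma space_batch_algebra [simp]: "space (batch_algebra t) = space M"
  by (simp add: batch_algebra_def space_measure_of_conv)

lemma sample_measurable: "t < T \<Longrightarrow> i < m t \<Longrightarrow> S t i \<in> M \<rightarrow>\<^sub>M D"
  using sample_distr by blast

lemma iterate_history: "s \<le> t \<Longrightarrow> X s \<in> borel_measurable (history_algebra t)"
  by (rule measurableI) (auto simp: sets_history_algebra history_def intro!: sigma_sets.Basic)

lemma sample_history:
  assumes "s < t" "t \<le> T" "i < m s"
  shows "S s i \<in> history_algebra t \<rightarrow>\<^sub>M D"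
proof (rule measurableI)
  show "S s i \<omega> \<in> space D" if "\<omega> \<in> space (history_algebra t)" for \<omega>
    using sample_measurable[of s i] assms that by (auto dest: measurable_space)
  show "S s i -` A \<inter> space (history_algebra t) \<in> sets (history_algebra t)" if "A \<in> sets D" for A
    unfolding sets_history_algebra history_def space_history_algebra
    using assms that by (intro sigma_sets.Basic) auto
qed

lemma sample_batch:
  assumes "t < T" "i < m t"
  shows "S t i \<in> batch_algebra t \<rightarrow>\<^sub>M D"
proof (rule measurableI)
  show "S t i \<omega> \<in> space D" if "\<omega> \<in> space (batch_algebra t)" for \<omega>
    using sample_measurable[of t i] assms that by (auto dest: measurable_space)
  show "S t i -` A \<inter> space (batch_algebra t) \<in> sets (batch_algebra t)" if "A \<in> sets D" for A
    unfolding sets_batch_algebra batch_events_def space_batch_algebra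
    using assms that by (intro sigma_sets.Basic) auto
qed

text \<open>The batch is treated as one random element of a product space. Its independence from the
  history, for which \<open>X t\<close> is measurable, allows the iterate to be held fixed while the
  batch is averaged.\<close>

lemma nn_integral_iterate_batch:
  assumes "t < T" and meas: "h \<in> borel_measurable (borel \<Otimes>\<^sub>M (\<Pi>\<^sub>M i\<in>{..<m t}. D))"
  shows "(\<integral>\<^sup>+\<omega>. h (X t \<omega>, \<lambda>i\<in>{..<m t}. S t i \<omega>) \<partial>M)
    = (\<integral>\<^sup>+\<omega>. \<integral>\<^sup>+\<omega>'. h (X t \<omega>, \<lambda>i\<in>{..<m t}. S t i \<omega>') \<partial>M \<partial>M)"
proof (rule nn_integral_indep_sigma[OF _ _ _ _ _ meas])
  show "indep_set (sets (history_algebra t)) (sets (batch_algebra t))"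
    unfolding sets_history_algebra sets_batch_algebra by (rule batch_fresh[OF assms(1)])
  show "X t \<in> borel_measurable (history_algebra t)"
    by (rule iterate_history) simp
  show "(\<lambda>\<omega>. \<lambda>i\<in>{..<m t}. S t i \<omega>) \<in> batch_algebra t \<rightarrow>\<^sub>M (\<Pi>\<^sub>M i\<in>{..<m t}. D)"
    by (rule measurable_restrict) (use assms sample_batch in auto)
qed simp_all

text \<open>Independence of two set systems includes that both consist of events, so
  \<open>output_indep\<close> already places the history inside \<open>sets M\<close>.\<close>

lemma history_measurable: "g \<in> history_algebra T \<rightarrow>\<^sub>M N \<Longrightarrow> g \<in> M \<rightarrow>\<^sub>M N"
proof -
  have "sets (history_algebra T) \<subseteq> sets M"
    using output_indep by (auto simp: indep_sets2_eq sets_history_algebra)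
  from measurable_mono[OF order_refl refl this, of N]
  show "g \<in> history_algebra T \<rightarrow>\<^sub>M N \<Longrightarrow> g \<in> M \<rightarrow>\<^sub>M N" by auto
qed

lemma output_range: "\<omega> \<in> space M \<Longrightarrow> R \<omega> \<in> {1..T}"
  using measurable_space[OF output_measurable] by simp

text \<open>The family \<open>v\<close> is bundled into one history-measurable element of a finite
  product and evaluated at \<open>R\<close>. Independence of \<open>R\<close> from the history
  separates the two sources of randomness, and uniformity turns the integral over \<open>R\<close>
  into an average.\<close>

lemma nn_integral_output:
  fixes v :: "nat \<Rightarrow> 'w \<Rightarrow> 'b::euclidean_space"
  assumes v: "\<And>k. k \<in> {1..T} \<Longrightarrow> v k \<in> borel_measurable (history_algebra T)"
  shows "(\<integral>\<^sup>+\<omega>. ennreal ((norm (v (R \<omega>) \<omega>))\<^sup>2) \<partial>M)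
    = (\<Sum>k\<in>{1..T}. ennreal (1 / real T) * (\<integral>\<^sup>+\<omega>. ennreal ((norm (v k \<omega>))\<^sup>2) \<partial>M))"
proof -
  let ?A = "vimage_algebra (space M) R (count_space {1..T})"
  have R: "R \<in> space M \<rightarrow> space (count_space {1..T})"
    using output_range by auto
  have indep: "indep_set (sets ?A) (sets (history_algebra T))"
    using output_indep unfolding sets_vimage_algebra2[OF R] sets_history_algebra by simp
  have family: "(\<lambda>\<omega>. \<lambda>k\<in>{1..T}. v k \<omega>) \<in> history_algebra T \<rightarrow>\<^sub>M (\<Pi>\<^sub>M k\<in>{1..T}. borel)"
    by (rule measurable_restrict) (rule v)
  \<comment> \<open>Evaluation at a variable index is jointly measurable because the index set is
    countable.\<close>
  have meas: "(\<lambda>p. ennreal ((norm (snd p (fst p) :: 'b))\<^sup>2))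
      \<in> borel_measurable (count_space {1..T} \<Otimes>\<^sub>M (\<Pi>\<^sub>M k\<in>{1..T}. borel))"
    by (rule measurable_compose_countable'[where I = "{1..T}" and g = fst
          and f = "\<lambda>k p. ennreal ((norm (snd p k))\<^sup>2)"]) measurable
  have "(\<integral>\<^sup>+\<omega>. ennreal ((norm (v (R \<omega>) \<omega>))\<^sup>2) \<partial>M) =
      (\<integral>\<^sup>+\<omega>. ennreal ((norm ((\<lambda>k\<in>{1..T}. v k \<omega>) (R \<omega>)))\<^sup>2) \<partial>M)"
    using output_range by (intro nn_integral_cong) simp
  also have "\<dots> = (\<integral>\<^sup>+\<omega>. \<integral>\<^sup>+\<omega>'. ennreal ((norm ((\<lambda>k\<in>{1..T}. v k \<omega>') (R \<omega>)))\<^sup>2) \<partial>M \<partial>M)"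
    using nn_integral_indep_sigma[OF _ _ _ _ _ meas, of ?A "history_algebra T" R "\<lambda>\<omega>. \<lambda>k\<in>{1..T}. v k \<omega>"]
      indep measurable_vimage_algebra1[OF R] family by simp
  also have "\<dots> = (\<integral>\<^sup>+\<omega>. \<integral>\<^sup>+\<omega>'. ennreal ((norm (v (R \<omega>) \<omega>'))\<^sup>2) \<partial>M \<partial>M)"
    using output_range by (intro nn_integral_cong) simp
  also have "\<dots> = (\<integral>\<^sup>+k. \<integral>\<^sup>+\<omega>'. ennreal ((norm (v k \<omega>'))\<^sup>2) \<partial>M \<partial>distr M (count_space {1..T}) R)"
    by (subst nn_integral_distr[OF output_measurable]) simp_all
  also have "\<dots> = (\<Sum>k\<in>{1..T}. ennreal (1 / real T) * (\<integral>\<^sup>+\<omega>. ennreal ((norm (v k \<omega>))\<^sup>2) \<partial>M))"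
    unfolding output_uniform uniform_count_measure_def
    by (subst nn_integral_point_measure_finite) auto
  finally show ?thesis .
qed

definition batch_mean :: "nat \<Rightarrow> 'w \<Rightarrow> 'a" where
  "batch_mean t \<omega> = (1 / real (m t)) *\<^sub>R (\<Sum>i<m t. G (X t \<omega>) (S t i \<omega>))"

end

section \<open>Finiteness of the objective values\<close>

lemma minimizer_finite:
  assumes "proper_fun r" and minimizer: "\<And>x. ereal (f xstar) + r xstar \<le> ereal (f x) + r x"
  shows "\<bar>r xstar\<bar> \<noteq> \<infinity>"
proof -
  obtain z where z: "r z \<noteq> \<infinity>" using assms by (auto simp: proper_fun_def)
  have "r xstar \<noteq> -\<infinity>" "r z \<noteq> -\<infinity>" using assms by (auto simp: proper_fun_def)
  then show ?thesis
    using minimizer[of z] z by (cases "r xstar"; cases "r z") auto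
qed

lemma start_finite_of_gap:
  assumes "proper_fun r" and minimizer: "\<And>x. ereal (f xstar) + r xstar \<le> ereal (f x) + r x"
    and gap: "(ereal (f x0) + r x0) - (ereal (f xstar) + r xstar) \<le> ereal \<Delta>"
  shows "\<bar>r x0\<bar> \<noteq> \<infinity>"
proof -
  have "r x0 \<noteq> -\<infinity>" using assms by (auto simp: proper_fun_def)
  then show ?thesis
    using gap minimizer_finite[OF assms(1) minimizer] by (cases "r xstar"; cases "r x0") auto
qed

lemma nonneg_of_gap:
  assumes "proper_fun r" and minimizer: "\<And>x. ereal (f xstar) + r xstar \<le> ereal (f x) + r x"
    and gap: "(ereal (f x0) + r x0) - (ereal (f xstar) + r xstar) \<le> ereal \<Delta>"
  shows "0 \<le> \<Delta>"
  using gap minimizer[of x0] start_finite_of_gap[OF assms] minimizer_finite[OF assms(1) minimizer]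
  by (cases "r xstar"; cases "r x0") auto

section \<open>Moment bounds along a run\<close>

text \<open>Joint measurability of \<open>G\<close> is a hypothesis here; the theorem derives it
  from the differentiability of the sampled functions. The batch sizes are arbitrary positive
  numbers, and the choice \<open>b * (t + 1)\<close> is made only in the theorem.\<close>

locale mb_spg_problem = mb_spg_run M D G r \<eta> m x0 T X S R
  for M :: "'w measure" and D :: "'s measure" and G :: "'a::euclidean_space \<Rightarrow> 's \<Rightarrow> 'a"
    and r \<eta> m x0 T X S R +
  fixes f :: "'a \<Rightarrow> real" and gradf :: "'a \<Rightarrow> 'a" and \<sigma> \<Delta> L c :: real and xstar :: 'a
  assumes proper: "proper_fun r"
    and gradient_measurable: "(\<lambda>p. G (fst p) (snd p)) \<in> borel_measurable (borel \<Otimes>\<^sub>M D)"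
    and unbiased: "\<And>x. integrable D (G x)" "\<And>x. (\<integral>\<xi>. G x \<xi> \<partial>D) = gradf x"
    and variance: "\<And>x. (\<integral>\<^sup>+\<xi>. ennreal ((norm (G x \<xi> - gradf x))\<^sup>2) \<partial>D) \<le> ennreal (\<sigma>\<^sup>2)"
    and minimizer: "\<And>x. ereal (f xstar) + r xstar \<le> ereal (f x) + r x"
    and gap: "(ereal (f x0) + r x0) - (ereal (f xstar) + r xstar) \<le> ereal \<Delta>"
    and f_grad: "\<And>x. GDERIV f x :> gradf x"
    and smooth: "0 < L" "\<And>x y. norm (gradf x - gradf y) \<le> L * norm (x - y)"
    and step_size: "0 < c" "c < 1 / 2" "\<eta> = c / L"
    and batch_pos: "\<And>t. 0 < m t"
begin

lemma step_pos: "0 < \<eta>"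
  using smooth step_size by simp

lemma gradf_measurable [measurable]: "gradf \<in> borel_measurable borel"
proof -
  have "continuous_on UNIV gradf"
    by (rule lipschitz_on_continuous_on[of L])
      (use smooth in \<open>auto intro!: lipschitz_onI simp: dist_norm\<close>)
  then show ?thesis by (rule borel_measurable_continuous_onI)
qed

lemma gradient_compose:
  assumes "u \<in> borel_measurable N" "s \<in> N \<rightarrow>\<^sub>M D"
  shows "(\<lambda>\<omega>. G (u \<omega>) (s \<omega>)) \<in> borel_measurable N"
  using measurable_compose[OF measurable_Pair[OF assms] gradient_measurable] by simp

text \<open>At a fixed point \<open>x\<close> the centered samples are independent with second
  moment at most \<open>\<sigma>\<^sup>2\<close>; their sum has second moment at most
  \<open>m t * \<sigma>\<^sup>2\<close>, and averaging divides this by the square of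
  \<open>m t\<close>.\<close>

lemma batch_variance:
  assumes "t < T"
  shows "(\<integral>\<^sup>+\<omega>. ennreal ((norm ((1 / real (m t)) *\<^sub>R (\<Sum>i<m t. G x (S t i \<omega>)) - gradf x))\<^sup>2) \<partial>M)
    \<le> ennreal (\<sigma>\<^sup>2 / real (m t))"
proof -
  define Y where "Y = (\<lambda>i \<omega>. G x (S t i \<omega>) - gradf x)"
  have G [measurable]: "G x \<in> borel_measurable D"
    using unbiased(1)[of x] by simp
  have S: "S t i \<in> M \<rightarrow>\<^sub>M D" "distr M D (S t i) = D" if "i < m t" for i
    using sample_distr[OF assms that] by auto
  have "(\<integral>\<^sup>+\<omega>. ennreal ((norm (\<Sum>i<m t. Y i \<omega>))\<^sup>2) \<partial>M) \<le> ennreal (real (card {..<m t}) * \<sigma>\<^sup>2)"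
  proof (rule nn_integral_norm_sum_indep)
    show "indep_vars (\<lambda>_. borel) Y {..<m t}"
      unfolding Y_def by (rule indep_vars_compose2[OF sample_indep[OF assms]]) measurable
  next
    fix i assume "i \<in> {..<m t}"
    then have i: "i < m t" by simp
    have int: "integrable M (\<lambda>\<omega>. G x (S t i \<omega>))"
      using unbiased(1)[of x] by (subst integrable_distr_eq[OF S(1)[OF i] G, symmetric]) (simp add: S(2)[OF i])
    then show "integrable M (Y i)"
      by (simp add: Y_def)
    have "(\<integral>\<omega>. G x (S t i \<omega>) \<partial>M) = gradf x"
      using unbiased(2)[of x] by (subst integral_distr[OF S(1)[OF i] G, symmetric]) (simp add: S(2)[OF i])
    then show "(\<integral>\<omega>. Y i \<omega> \<partial>M) = 0"
      using int by (simp add: Y_def prob_space)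
    have "(\<integral>\<^sup>+\<omega>. ennreal ((norm (Y i \<omega>))\<^sup>2) \<partial>M) =
        (\<integral>\<^sup>+\<xi>. ennreal ((norm (G x \<xi> - gradf x))\<^sup>2) \<partial>distr M D (S t i))"
      unfolding Y_def by (subst nn_integral_distr[OF S(1)[OF i]]) auto
    then show "(\<integral>\<^sup>+\<omega>. ennreal ((norm (Y i \<omega>))\<^sup>2) \<partial>M) \<le> ennreal (\<sigma>\<^sup>2)"
      using variance by (simp add: S(2)[OF i])
  qed auto
  then have *: "(\<integral>\<^sup>+\<omega>. ennreal ((norm (\<Sum>i<m t. Y i \<omega>))\<^sup>2) \<partial>M) \<le> ennreal (real (m t) * \<sigma>\<^sup>2)"
    by simp
  have [measurable]: "Y i \<in> borel_measurable M" if "i < m t" for i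
    unfolding Y_def using S(1)[OF that] by measurable
  have mean: "(1 / real (m t)) *\<^sub>R (\<Sum>i<m t. G x (S t i \<omega>)) - gradf x = (1 / real (m t)) *\<^sub>R (\<Sum>i<m t. Y i \<omega>)" for \<omega>
    using batch_pos[of t] by (simp add: Y_def sum_subtractf scaleR_diff_right sum_constant_scaleR)
  have "(\<integral>\<^sup>+\<omega>. ennreal ((norm ((1 / real (m t)) *\<^sub>R (\<Sum>i<m t. G x (S t i \<omega>)) - gradf x))\<^sup>2) \<partial>M)
      = (\<integral>\<^sup>+\<omega>. ennreal ((1 / real (m t))\<^sup>2) * ennreal ((norm (\<Sum>i<m t. Y i \<omega>))\<^sup>2) \<partial>M)"
    unfolding mean by (simp add: ennreal_mult'[symmetric] power_mult_distrib power_divide)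
  also have "\<dots> = ennreal ((1 / real (m t))\<^sup>2) * (\<integral>\<^sup>+\<omega>. ennreal ((norm (\<Sum>i<m t. Y i \<omega>))\<^sup>2) \<partial>M)"
    by (rule nn_integral_cmult) measurable
  also have "\<dots> \<le> ennreal ((1 / real (m t))\<^sup>2) * ennreal (real (m t) * \<sigma>\<^sup>2)"
    using * by (rule mult_left_mono) simp
  also have "\<dots> = ennreal (\<sigma>\<^sup>2 / real (m t))"
    using batch_pos[of t] by (simp add: ennreal_mult'[symmetric] power2_eq_square)
  finally show ?thesis .
qed

text \<open>The bound \<open>batch_variance\<close> is uniform in the point, so it survives
  inserting the random iterate once independence has frozen that iterate.\<close>

lemma gradient_error:
  assumes "t < T"
  shows "(\<integral>\<^sup>+\<omega>. ennreal ((norm (batch_mean t \<omega> - gradf (X t \<omega>)))\<^sup>2) \<partial>M) \<le> ennreal (\<sigma>\<^sup>2 / real (m t))"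
proof -
  let ?P = "borel \<Otimes>\<^sub>M (\<Pi>\<^sub>M i\<in>{..<m t}. D)"
  let ?err = "\<lambda>p. (1 / real (m t)) *\<^sub>R (\<Sum>i<m t. G (fst p) (snd p i)) - gradf (fst p)"
  have [measurable]: "(\<lambda>p. G (fst p) (snd p i)) \<in> borel_measurable ?P" if "i < m t" for i
    by (rule gradient_compose[OF measurable_fst])
      (rule measurable_compose[OF measurable_snd measurable_component_singleton], use that in simp)
  have meas: "(\<lambda>p. ennreal ((norm (?err p))\<^sup>2)) \<in> borel_measurable ?P"
    by measurable
  have "(\<integral>\<^sup>+\<omega>. ennreal ((norm (batch_mean t \<omega> - gradf (X t \<omega>)))\<^sup>2) \<partial>M) =
      (\<integral>\<^sup>+\<omega>. ennreal ((norm (?err (X t \<omega>, \<lambda>i\<in>{..<m t}. S t i \<omega>)))\<^sup>2) \<partial>M)"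
    by (simp add: batch_mean_def)
  also have "\<dots> = (\<integral>\<^sup>+\<omega>. \<integral>\<^sup>+\<omega>'. ennreal ((norm (?err (X t \<omega>, \<lambda>i\<in>{..<m t}. S t i \<omega>')))\<^sup>2) \<partial>M \<partial>M)"
    by (rule nn_integral_iterate_batch[OF assms meas])
  also have "\<dots> \<le> (\<integral>\<^sup>+\<omega>. ennreal (\<sigma>\<^sup>2 / real (m t)) \<partial>M)"
    using batch_variance[OF assms] by (intro nn_integral_mono) simp
  also have "\<dots> = ennreal (\<sigma>\<^sup>2 / real (m t))"
    by (simp add: emeasure_space_1)
  finally show ?thesis .
qed

text \<open>The vector from \<open>prox_step_subgradient\<close>, indexed by the iterate at which it
  is a subgradient. For \<open>k \<ge> 1\<close>, the step producing \<open>X k\<close> is the one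
  numbered \<open>k - 1\<close>.\<close>

definition subgrad :: "nat \<Rightarrow> 'w \<Rightarrow> 'a" where
  "subgrad k \<omega> = gradf (X k \<omega>) - batch_mean (k - 1) \<omega> - (1 / \<eta>) *\<^sub>R (X k \<omega> - X (k - 1) \<omega>)"

lemma step': "t < T \<Longrightarrow> \<omega> \<in> space M \<Longrightarrow> X (Suc t) \<omega> \<in> prox \<eta> r (X t \<omega> - \<eta> *\<^sub>R batch_mean t \<omega>)"
  using step by (simp add: batch_mean_def)

lemma subgrad_mem:
  assumes "k \<in> {1..T}" "\<omega> \<in> space M"
  shows "subgrad k \<omega> \<in> frechet_subdiff (\<lambda>x. ereal (f x) + r x) (X k \<omega>)"
proof -
  obtain t where "k = Suc t" "t < T" using assms(1) by (cases k) auto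
  then show ?thesis
    using prox_step_subgradient[OF f_grad smooth(2) proper step_pos step'[of t \<omega>]] assms(2)
    by (simp add: subgrad_def)
qed

text \<open>The vector involves the batch of step \<open>k - 1\<close> besides two iterates; since
  \<open>k - 1 < T\<close>, all of them belong to the history at time \<open>T\<close>, from which
  \<open>R\<close> is independent.\<close>

lemma subgrad_measurable:
  assumes "k \<in> {1..T}"
  shows "subgrad k \<in> borel_measurable (history_algebra T)"
proof -
  have k: "k \<le> T" "k - 1 \<le> T" "k - 1 < T" using assms by auto
  have [measurable]: "X k \<in> borel_measurable (history_algebra T)"
      "X (k - 1) \<in> borel_measurable (history_algebra T)"
    by (rule iterate_history, fact)+
  have [measurable]: "batch_mean (k - 1) \<in> borel_measurable (history_algebra T)"
    unfolding batch_mean_def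
    by (intro borel_measurable_scaleR borel_measurable_sum gradient_compose iterate_history sample_history)
      (use k in auto)
  show ?thesis unfolding subgrad_def by measurable
qed

lemmas minimum_finite = minimizer_finite[OF proper minimizer]
lemmas start_finite = start_finite_of_gap[OF proper minimizer gap]

lemma iterate_finite:
  assumes "t \<le> T" "\<omega> \<in> space M"
  shows "\<bar>r (X t \<omega>)\<bar> \<noteq> \<infinity>"
proof (cases t)
  case 0
  then show ?thesis using start_finite start[OF assms(2)] by simp
next
  case (Suc k)
  then show ?thesis using assms prox_finite[OF proper step'[of k \<omega>]] by simp
qed

lemmas gap_nonneg = nonneg_of_gap[OF proper minimizer gap]

definition C1 :: real where "C1 = (2 * c * (1 - 2 * c) + 2) / (c * (1 - 2 * c))"
definition C2 :: real where "C2 = (6 - 4 * c) / (1 - 2 * c)"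

lemma C1_nonneg: "0 \<le> C1" and C2_nonneg: "0 \<le> C2"
  using step_size by (auto simp: C1_def C2_def)

text \<open>A pathwise bound: the one-step estimates are summed, and the objective differences
  telescope to \<open>\<rho> 0 - \<rho> T\<close>, which the initial gap and the minimality of
  \<open>xstar\<close> bound by \<open>\<Delta>\<close>.\<close>

lemma sum_subgrad_le:
  assumes \<omega>: "\<omega> \<in> space M"
  shows "(\<Sum>k\<in>{1..T}. (norm (subgrad k \<omega>))\<^sup>2)
    \<le> C1 * (\<Sum>t<T. (norm (batch_mean t \<omega> - gradf (X t \<omega>)))\<^sup>2) + C2 * \<Delta> / \<eta>"
proof -
  \<comment> \<open>All iterates have finite \<open>r\<close>, so the objective along the path can
    be handled as a real number.\<close>
  define \<rho> where "\<rho> t = f (X t \<omega>) + real_of_ereal (r (X t \<omega>))" for t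
  have r: "r (X t \<omega>) = ereal (real_of_ereal (r (X t \<omega>)))" if "t \<le> T" for t
    using iterate_finite[OF that \<omega>] by (simp add: ereal_real)
  have bound: "(norm (subgrad (Suc t) \<omega>))\<^sup>2
      \<le> C1 * (norm (batch_mean t \<omega> - gradf (X t \<omega>)))\<^sup>2 + C2 / \<eta> * (\<rho> t - \<rho> (Suc t))" if "t < T" for t
    using prox_step_bound[OF f_grad smooth(2) smooth(1) step_size r r step'[OF that \<omega>]] that
    by (simp add: subgrad_def \<rho>_def C1_def C2_def)
  have "(\<Sum>k\<in>{1..T}. (norm (subgrad k \<omega>))\<^sup>2) = (\<Sum>t<T. (norm (subgrad (Suc t) \<omega>))\<^sup>2)"
    by (rule sum.reindex_bij_witness[of _ Suc "\<lambda>k. k - 1"]) auto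
  also have "\<dots> \<le> (\<Sum>t<T. C1 * (norm (batch_mean t \<omega> - gradf (X t \<omega>)))\<^sup>2 + C2 / \<eta> * (\<rho> t - \<rho> (Suc t)))"
    using bound by (intro sum_mono) simp
  also have "\<dots> = C1 * (\<Sum>t<T. (norm (batch_mean t \<omega> - gradf (X t \<omega>)))\<^sup>2) + C2 / \<eta> * (\<rho> 0 - \<rho> T)"
    by (simp only: sum.distrib sum_distrib_left[symmetric] sum_lessThan_telescope')
  also have "\<rho> 0 - \<rho> T \<le> \<Delta>"
  proof -
    obtain s where s: "r xstar = ereal s" using minimum_finite by auto
    have "X 0 \<omega> = x0" by (rule start[OF \<omega>])
    then have "\<rho> 0 - (f xstar + s) \<le> \<Delta>"
      using gap r[of 0] s unfolding \<rho>_def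
      by (metis ereal_less_eq(3) ereal_minus(1) plus_ereal.simps(1) zero_le)
    moreover have "f xstar + s \<le> \<rho> T"
      using minimizer[of "X T \<omega>"] r[of T] s unfolding \<rho>_def
      by (metis ereal_less_eq(3) plus_ereal.simps(1) order_refl)
    ultimately show ?thesis by simp
  qed
  then have "C2 / \<eta> * (\<rho> 0 - \<rho> T) \<le> C2 / \<eta> * \<Delta>"
    using C2_nonneg step_pos by (intro mult_left_mono) auto
  finally show ?thesis by simp
qed

text \<open>The pathwise bound is integrated, each squared gradient error is replaced by its bound
  \<open>\<sigma>\<^sup>2 / m t\<close>, and the uniform output index divides the sum by
  \<open>T\<close>.\<close>

lemma output_second_moment:
  assumes "1 \<le> T"
  shows "(\<integral>\<^sup>+\<omega>. ennreal ((norm (subgrad (R \<omega>) \<omega>))\<^sup>2) \<partial>M)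
    \<le> ennreal ((C1 * \<sigma>\<^sup>2 * (\<Sum>t<T. 1 / real (m t)) + C2 * \<Delta> / \<eta>) / real T)"
proof -
  have [measurable]: "subgrad k \<in> borel_measurable M" if "k \<in> {1..T}" for k
    using history_measurable subgrad_measurable[OF that] by blast
  have [measurable]: "(\<lambda>\<omega>. batch_mean t \<omega> - gradf (X t \<omega>)) \<in> borel_measurable M" if "t < T" for t
  proof -
    have [measurable]: "X t \<in> borel_measurable M" using that by (intro iterate_measurable) simp
    have [measurable]: "batch_mean t \<in> borel_measurable M"
      unfolding batch_mean_def
      by (intro borel_measurable_scaleR borel_measurable_sum gradient_compose sample_measurable)
        (use that in auto)
    show ?thesis by measurable
  qed
  have "(\<Sum>k\<in>{1..T}. \<integral>\<^sup>+\<omega>. ennreal ((norm (subgrad k \<omega>))\<^sup>2) \<partial>M)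
      = (\<integral>\<^sup>+\<omega>. (\<Sum>k\<in>{1..T}. ennreal ((norm (subgrad k \<omega>))\<^sup>2)) \<partial>M)"
    by (rule nn_integral_sum[symmetric]) measurable
  also have "\<dots> \<le> (\<integral>\<^sup>+\<omega>. ennreal C1 * (\<Sum>t<T. ennreal ((norm (batch_mean t \<omega> - gradf (X t \<omega>)))\<^sup>2))
      + ennreal (C2 * \<Delta> / \<eta>) \<partial>M)"
  proof (rule nn_integral_mono)
    fix \<omega> assume "\<omega> \<in> space M"
    from ennreal_leI[OF sum_subgrad_le[OF this]]
    show "(\<Sum>k\<in>{1..T}. ennreal ((norm (subgrad k \<omega>))\<^sup>2))
        \<le> ennreal C1 * (\<Sum>t<T. ennreal ((norm (batch_mean t \<omega> - gradf (X t \<omega>)))\<^sup>2)) + ennreal (C2 * \<Delta> / \<eta>)"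
      using C1_nonneg C2_nonneg gap_nonneg step_pos
      by (simp add: sum_ennreal ennreal_plus ennreal_mult sum_nonneg)
  qed
  also have "\<dots> = ennreal C1 * (\<Sum>t<T. \<integral>\<^sup>+\<omega>. ennreal ((norm (batch_mean t \<omega> - gradf (X t \<omega>)))\<^sup>2) \<partial>M)
      + ennreal (C2 * \<Delta> / \<eta>)"
    by (subst nn_integral_add, measurable, subst nn_integral_cmult, measurable, subst nn_integral_sum, measurable)
      (simp add: emeasure_space_1)
  also have "\<dots> \<le> ennreal C1 * (\<Sum>t<T. ennreal (\<sigma>\<^sup>2 / real (m t))) + ennreal (C2 * \<Delta> / \<eta>)"
    by (intro add_right_mono mult_left_mono sum_mono gradient_error) auto
  also have "\<dots> = ennreal (C1 * \<sigma>\<^sup>2 * (\<Sum>t<T. 1 / real (m t)) + C2 * \<Delta> / \<eta>)"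
    using C1_nonneg C2_nonneg gap_nonneg step_pos
    by (simp add: sum_ennreal ennreal_plus ennreal_mult'[symmetric] sum_nonneg sum_distrib_left mult.assoc)
  finally have "ennreal (1 / real T) * (\<Sum>k\<in>{1..T}. \<integral>\<^sup>+\<omega>. ennreal ((norm (subgrad k \<omega>))\<^sup>2) \<partial>M)
      \<le> ennreal (1 / real T) * ennreal (C1 * \<sigma>\<^sup>2 * (\<Sum>t<T. 1 / real (m t)) + C2 * \<Delta> / \<eta>)"
    by (rule mult_left_mono) simp
  moreover have "(\<integral>\<^sup>+\<omega>. ennreal ((norm (subgrad (R \<omega>) \<omega>))\<^sup>2) \<partial>M)
      = (\<Sum>k\<in>{1..T}. ennreal (1 / real T) * (\<integral>\<^sup>+\<omega>. ennreal ((norm (subgrad k \<omega>))\<^sup>2) \<partial>M))"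
    by (rule nn_integral_output[OF subgrad_measurable])
  ultimately show ?thesis
    by (simp add: sum_distrib_left ennreal_mult'[symmetric])
qed

lemma output_subgrad_measurable: "(\<lambda>\<omega>. subgrad (R \<omega>) \<omega>) \<in> borel_measurable M"
proof (rule measurable_compose_countable'[OF _ output_measurable])
  show "subgrad k \<in> borel_measurable M" if "k \<in> {1..T}" for k
    using history_measurable subgrad_measurable[OF that] by blast
qed simp

text \<open>Replaces the infimum by a measurable majorant; both expectation bounds below go through
  it.\<close>

lemma dist_zero_output_le:
  assumes "\<omega> \<in> space M"
  shows "dist_zero (frechet_subdiff (\<lambda>x. ereal (f x) + r x) (X (R \<omega>) \<omega>)) \<le> ennreal (norm (subgrad (R \<omega>) \<omega>))"
  unfolding dist_zero_def
  by (rule INF_lower) (rule subgrad_mem[OF output_range[OF assms] assms])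

lemma expected_dist_sq_le:
  assumes "1 \<le> T"
  shows "(\<integral>\<^sup>+\<omega>. (dist_zero (frechet_subdiff (\<lambda>x. ereal (f x) + r x) (X (R \<omega>) \<omega>)))\<^sup>2 \<partial>M)
    \<le> ennreal ((C1 * \<sigma>\<^sup>2 * (\<Sum>t<T. 1 / real (m t)) + C2 * \<Delta> / \<eta>) / real T)"
proof (rule order_trans[OF nn_integral_mono output_second_moment[OF assms]])
  fix \<omega> assume "\<omega> \<in> space M"
  from power_mono[OF dist_zero_output_le[OF this], of 2]
  show "(dist_zero (frechet_subdiff (\<lambda>x. ereal (f x) + r x) (X (R \<omega>) \<omega>)))\<^sup>2 \<le> ennreal ((norm (subgrad (R \<omega>) \<omega>))\<^sup>2)"
    by (simp add: ennreal_power)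
qed

text \<open>The passage from second to first moment uses
  \<open>s \<le> \<epsilon> / 2 + s\<^sup>2 / (2 * \<epsilon>)\<close>, a rearrangement of
  \<open>0 \<le> (s - \<epsilon>)\<^sup>2\<close>; a second moment of at most
  \<open>\<epsilon>\<^sup>2\<close> makes the expected right side at most
  \<open>\<epsilon>\<close>.\<close>

lemma expected_dist_le:
  assumes "1 \<le> T" "0 < \<epsilon>"
    and "(C1 * \<sigma>\<^sup>2 * (\<Sum>t<T. 1 / real (m t)) + C2 * \<Delta> / \<eta>) / real T \<le> \<epsilon>\<^sup>2"
  shows "(\<integral>\<^sup>+\<omega>. dist_zero (frechet_subdiff (\<lambda>x. ereal (f x) + r x) (X (R \<omega>) \<omega>)) \<partial>M) \<le> ennreal \<epsilon>"
proof -
  note [measurable] = output_subgrad_measurable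
  have "(\<integral>\<^sup>+\<omega>. dist_zero (frechet_subdiff (\<lambda>x. ereal (f x) + r x) (X (R \<omega>) \<omega>)) \<partial>M)
      \<le> (\<integral>\<^sup>+\<omega>. ennreal (\<epsilon> / 2) + ennreal (1 / (2 * \<epsilon>)) * ennreal ((norm (subgrad (R \<omega>) \<omega>))\<^sup>2) \<partial>M)"
  proof (rule nn_integral_mono)
    fix \<omega> assume "\<omega> \<in> space M"
    note dist_zero_output_le[OF this]
    also have "norm (subgrad (R \<omega>) \<omega>) \<le> \<epsilon> / 2 + 1 / (2 * \<epsilon>) * (norm (subgrad (R \<omega>) \<omega>))\<^sup>2"
      using zero_le_power2[of "norm (subgrad (R \<omega>) \<omega>) - \<epsilon>"] \<open>0 < \<epsilon>\<close>
      by (simp add: field_simps power2_eq_square)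
    finally show "dist_zero (frechet_subdiff (\<lambda>x. ereal (f x) + r x) (X (R \<omega>) \<omega>))
        \<le> ennreal (\<epsilon> / 2) + ennreal (1 / (2 * \<epsilon>)) * ennreal ((norm (subgrad (R \<omega>) \<omega>))\<^sup>2)"
      using \<open>0 < \<epsilon>\<close> by (simp add: ennreal_leI ennreal_plus[symmetric] ennreal_mult'[symmetric] del: ennreal_plus)
  qed
  also have "\<dots> = ennreal (\<epsilon> / 2) + ennreal (1 / (2 * \<epsilon>)) * (\<integral>\<^sup>+\<omega>. ennreal ((norm (subgrad (R \<omega>) \<omega>))\<^sup>2) \<partial>M)"
    by (subst nn_integral_add, measurable, subst nn_integral_cmult, measurable)
      (simp add: emeasure_space_1)
  also have "\<dots> \<le> ennreal (\<epsilon> / 2) + ennreal (1 / (2 * \<epsilon>)) * ennreal (\<epsilon>\<^sup>2)"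
    by (intro add_left_mono mult_left_mono order_trans[OF output_second_moment[OF assms(1)]] ennreal_leI assms(3)) auto
  also have "\<dots> = ennreal \<epsilon>"
    using \<open>0 < \<epsilon>\<close>
    by (simp add: ennreal_plus[symmetric] ennreal_mult'[symmetric] power2_eq_square del: ennreal_plus)
  finally show ?thesis .
qed

end

section \<open>The iteration count\<close>

lemma antimono_ln_div:
  fixes u x :: real
  assumes "1 \<le> u" "u \<le> x"
  shows "(ln x + 1) / x \<le> (ln u + 1) / u"
proof (rule DERIV_nonpos_imp_nonincreasing[OF assms(2)])
  fix t assume "u \<le> t" "t \<le> x"
  with assms have t: "1 \<le> t" by simp
  have "((\<lambda>x. (ln x + 1) / x) has_real_derivative (- ln t / t\<^sup>2)) (at t)"
    using t by (auto intro!: derivative_eq_intros simp: field_simps power2_eq_square)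
  with t show "\<exists>y. ((\<lambda>x. (ln x + 1) / x) has_real_derivative y) (at t) \<and> y \<le> 0"
    by (intro exI[of _ "- ln t / t\<^sup>2"]) auto
qed

text \<open>The guarantee on the expected squared distance after \<open>u\<close> iterations, with
  \<open>A\<close> and \<open>B\<close> collecting the problem constants. The real argument lets it
  be evaluated at non-integers, as in \<open>rate_bound_inverse\<close>.\<close>

definition rate_bound :: "real \<Rightarrow> real \<Rightarrow> real \<Rightarrow> real" where
  "rate_bound A B u = A * ((ln u + 1) / u) + B / u"

lemma rate_bound_antimono:
  assumes "0 \<le> A" "0 \<le> B" "1 \<le> u" "u \<le> x"
  shows "rate_bound A B x \<le> rate_bound A B u"
proof -
  have "B / x \<le> B / u"
    using assms by (intro divide_left_mono) auto
  then show ?thesis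
    unfolding rate_bound_def using assms antimono_ln_div[of u x]
    by (intro add_mono mult_left_mono) auto
qed

text \<open>The rate tends to 0; hence the \<open>LEAST\<close> in \<open>iteration_count\<close>
  denotes a number that has the required property.\<close>

lemma ex_rate_bound_le:
  assumes "0 < \<epsilon>"
  shows "\<exists>n::nat. 1 \<le> n \<and> rate_bound A B (real n) \<le> \<epsilon>\<^sup>2"
proof -
  have "((\<lambda>n::nat. rate_bound A B (real n)) \<longlongrightarrow> 0) at_top"
    unfolding rate_bound_def by real_asymp
  then have "eventually (\<lambda>n::nat. rate_bound A B (real n) < \<epsilon>\<^sup>2) at_top"
    by (rule order_tendstoD) (use assms in auto)
  with eventually_ge_at_top[of "1::nat"]
  have "eventually (\<lambda>n::nat. 1 \<le> n \<and> rate_bound A B (real n) \<le> \<epsilon>\<^sup>2) at_top"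
    by eventually_elim auto
  then show ?thesis by (auto simp: eventually_at_top_linorder)
qed

text \<open>It suffices to exhibit a real \<open>u \<epsilon>\<close> of the desired order at which
  the rate is at most \<open>\<epsilon>\<^sup>2\<close>. By monotonicity the same holds at its
  ceiling, which therefore bounds the least admissible number.\<close>

lemma rate_bound_inverse:
  assumes "0 \<le> A" "0 \<le> B"
  shows "(\<lambda>\<epsilon>. real (LEAST T. 1 \<le> T \<and> rate_bound A B (real T) \<le> \<epsilon>\<^sup>2))
    \<in> O[at_right 0](\<lambda>\<epsilon>. 1 / \<epsilon>\<^sup>2 * ln (1 / \<epsilon>) ^ 2)"
proof -
  \<comment> \<open>The logarithm is squared to make the rate at \<open>u \<epsilon>\<close> of
    smaller order than \<open>\<epsilon>\<^sup>2\<close>, whatever \<open>A\<close> and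
    \<open>B\<close> are: \<open>ln (u \<epsilon>)\<close> grows like
    \<open>2 * ln (1 / \<epsilon>)\<close>, so a single logarithm would give a ratio tending to
    \<open>2 * A\<close> only.\<close>
  define u where "u \<epsilon> = 1 / \<epsilon>\<^sup>2 * ln (1 / \<epsilon>) ^ 2" for \<epsilon> :: real
  have "((\<lambda>\<epsilon>. rate_bound A B (u \<epsilon>) / \<epsilon>\<^sup>2) \<longlongrightarrow> 0) (at_right 0)"
    unfolding rate_bound_def u_def by real_asymp
  then have "eventually (\<lambda>\<epsilon>. rate_bound A B (u \<epsilon>) / \<epsilon>\<^sup>2 < 1) (at_right 0)"
    by (rule order_tendstoD) simp
  moreover have "eventually (\<lambda>\<epsilon>. 1 \<le> u \<epsilon>) (at_right 0)"
    unfolding u_def by real_asymp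
  ultimately have "eventually (\<lambda>\<epsilon>. norm (real (LEAST T. 1 \<le> T \<and> rate_bound A B (real T) \<le> \<epsilon>\<^sup>2))
      \<le> 2 * norm (u \<epsilon>)) (at_right 0)"
    using eventually_at_right_less[of "0::real"]
  proof eventually_elim
    case (elim \<epsilon>)
    \<comment> \<open>Rounding up costs at most 1, which \<open>1 \<le> u \<epsilon>\<close> absorbs
      into the factor 2.\<close>
    define n where "n = nat \<lceil>u \<epsilon>\<rceil>"
    have n: "u \<epsilon> \<le> real n" "real n \<le> u \<epsilon> + 1"
      using elim(2) unfolding n_def by linarith+
    have "rate_bound A B (real n) \<le> rate_bound A B (u \<epsilon>)"
      by (rule rate_bound_antimono) (use assms elim n in auto)
    also have "\<dots> \<le> \<epsilon>\<^sup>2" using elim by (simp add: field_simps)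
    finally have "(LEAST T. 1 \<le> T \<and> rate_bound A B (real T) \<le> \<epsilon>\<^sup>2) \<le> n"
      using n elim(2) by (intro Least_le) auto
    then show ?case using n elim(2) by simp
  qed
  then show ?thesis unfolding u_def by (rule bigoI)
qed

text \<open>The left side is the harmonic number; its excess over \<open>ln n\<close> decreases in
  \<open>n\<close> and equals 1 at \<open>n = 1\<close>.\<close>

lemma sum_inverse_le_ln:
  assumes "1 \<le> n"
  shows "(\<Sum>t<n. 1 / real (t + 1)) \<le> ln (real n) + 1"
proof -
  have "(\<Sum>t<n. 1 / real (t + 1)) = harm n"
    unfolding harm_def by (rule sum.reindex_bij_witness[of _ "\<lambda>k. k - 1" Suc]) (auto simp: field_simps)
  then show ?thesis
    using euler_mascheroni_sequence_decreasing[of 1 n] assms by (simp add: harm_def)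
qed

lemma sum_batch_le: "(\<Sum>t<n. b * (t + 1)) \<le> b * n\<^sup>2" for n :: nat
proof -
  have "(\<Sum>t<n. b * (t + 1)) \<le> (\<Sum>t<n. b * n)" by (intro sum_mono mult_left_mono) auto
  then show ?thesis by (simp add: power2_eq_square algebra_simps)
qed

section \<open>Convergence rate and total complexity\<close>

theorem corollary2:
  fixes D :: "'s measure"
    and fs :: "real ^ 'd \<Rightarrow> 's \<Rightarrow> real"
    and G :: "real ^ 'd \<Rightarrow> 's \<Rightarrow> real ^ 'd"
    and f :: "real ^ 'd \<Rightarrow> real"
    and gradf :: "real ^ 'd \<Rightarrow> real ^ 'd"
    and r F :: "real ^ 'd \<Rightarrow> ereal"
    and x0 xstar :: "real ^ 'd"
    and \<sigma> \<Delta> L c \<eta> c1 c2 :: real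
    and b :: nat
  assumes "prob_space D"
    and f_expectation: "\<And>x. integrable D (fs x)" "\<And>x. f x = (\<integral>\<xi>. fs x \<xi> \<partial>D)"
    and stoch_grad: "\<And>x \<xi>. \<xi> \<in> space D \<Longrightarrow> GDERIV (\<lambda>y. fs y \<xi>) x :> G x \<xi>"
    and F_def: "\<And>x. F x = ereal (f x) + r x"
    and r: "proper_fun r" "lsc_fun r"
    and unbiased: "\<And>x. integrable D (G x)" "\<And>x. (\<integral>\<xi>. G x \<xi> \<partial>D) = gradf x"
    and variance: "0 < \<sigma>"
      "\<And>x. (\<integral>\<^sup>+\<xi>. ennreal ((norm (G x \<xi> - gradf x))\<^sup>2) \<partial>D) \<le> ennreal (\<sigma>\<^sup>2)"
    and minimizer: "\<And>x. F xstar \<le> F x"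
    and gap: "F x0 - F xstar \<le> ereal \<Delta>"
    and f_grad: "\<And>x. GDERIV f x :> gradf x"
    and smooth: "0 < L" "\<And>x y. norm (gradf x - gradf y) \<le> L * norm (x - y)"
    and step_size: "0 < c" "c < 1 / 2" "\<eta> = c / L"
    and prox_nonempty: "\<And>x. prox \<eta> r x \<noteq> {}"
    and constants: "c1 = (2 * c * (1 - 2 * c) + 2) / (c * (1 - 2 * c))"
      "c2 = (6 - 4 * c) / (1 - 2 * c)"
    and batch: "0 < b"
  shows
    "(\<forall>(M::'w measure) T X S R.
        1 \<le> T \<longrightarrow> mb_spg_run M D G r \<eta> (\<lambda>t. b * (t + 1)) x0 T X S R \<longrightarrow>
        (\<integral>\<^sup>+\<omega>. (dist_zero (frechet_subdiff F (X (R \<omega>) \<omega>)))\<^sup>2 \<partial>M)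
          \<le> ennreal (c1 * \<sigma>\<^sup>2 * (ln (real T) + 1) / (real b * real T) + c2 * \<Delta> / (\<eta> * real T)))
     \<and> (\<forall>\<epsilon>>0. \<forall>(M::'w measure) X S R.
        mb_spg_run M D G r \<eta> (\<lambda>t. b * (t + 1)) x0 (iteration_count b c L \<Delta> \<sigma> \<epsilon>) X S R \<longrightarrow>
        (\<integral>\<^sup>+\<omega>. dist_zero (frechet_subdiff F (X (R \<omega>) \<omega>)) \<partial>M) \<le> ennreal \<epsilon>)
     \<and> (\<lambda>\<epsilon>. real (iteration_count b c L \<Delta> \<sigma> \<epsilon>)) \<in> soft_O (\<lambda>\<epsilon>. 1 / \<epsilon>\<^sup>2)
     \<and> (\<lambda>\<epsilon>. real (\<Sum>t<iteration_count b c L \<Delta> \<sigma> \<epsilon>. b * (t + 1))) \<in> soft_O (\<lambda>\<epsilon>. 1 / \<epsilon> ^ 4)"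
proof -
  \<comment> \<open>With these coefficients the claimed right-hand side is
    \<open>rate_bound K1 K2\<close>.\<close>
  define K1 K2 where "K1 = c1 * \<sigma>\<^sup>2 / real b" and "K2 = c2 * \<Delta> / \<eta>"
  let ?N = "iteration_count b c L \<Delta> \<sigma>"
  have F: "F = (\<lambda>x. ereal (f x) + r x)"
    using F_def by blast
  have minimizer': "\<And>x. ereal (f xstar) + r xstar \<le> ereal (f x) + r x"
    and gap': "(ereal (f x0) + r x0) - (ereal (f xstar) + r xstar) \<le> ereal \<Delta>"
    using minimizer gap by (simp_all add: F_def)
  have K_nonneg: "0 \<le> K1" "0 \<le> K2"
    using step_size smooth(1) nonneg_of_gap[OF r(1) minimizer' gap']
    by (simp_all add: K1_def K2_def constants)
  have rate: "c1 * \<sigma>\<^sup>2 * (ln (real T) + 1) / (real b * real T) + c2 * \<Delta> / (\<eta> * real T) = rate_bound K1 K2 (real T)" for T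
    by (simp add: rate_bound_def K1_def K2_def)
  have N_eq: "?N \<epsilon> = (LEAST T. 1 \<le> T \<and> rate_bound K1 K2 (real T) \<le> \<epsilon>\<^sup>2)" for \<epsilon>
    unfolding iteration_count_def Let_def rate[symmetric] constants step_size(3) ..
  have N: "1 \<le> ?N \<epsilon>" "rate_bound K1 K2 (real (?N \<epsilon>)) \<le> \<epsilon>\<^sup>2" if "0 < \<epsilon>" for \<epsilon>
    using LeastI_ex[OF ex_rate_bound_le[OF that, of K1 K2]] unfolding N_eq by auto

  \<comment> \<open>Every run on the given data meets the hypotheses of the locale; joint
    measurability of \<open>G\<close> holds because \<open>G\<close> is the gradient of the sampled
    functions \<open>fs\<close>.\<close>
  have problem: "mb_spg_problem M D G r \<eta> (\<lambda>t. b * (t + 1)) x0 T X S R f gradf \<sigma> \<Delta> L c xstar"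
    if "mb_spg_run M D G r \<eta> (\<lambda>t. b * (t + 1)) x0 T X S R" for M :: "'w measure" and T X S R
  proof (rule mb_spg_problem.intro[OF that mb_spg_problem_axioms.intro])
    show "(\<lambda>p. G (fst p) (snd p)) \<in> borel_measurable (borel \<Otimes>\<^sub>M D)"
      by (rule borel_measurable_gradient[OF borel_measurable_integrable[OF f_expectation(1)] stoch_grad])
  qed (use r unbiased variance minimizer' gap' f_grad smooth step_size batch in auto)
  \<comment> \<open>With batch sizes \<open>b * (t + 1)\<close> the variance contributions form a
    harmonic sum, whose logarithmic bound yields the rate.\<close>
  have sum_le: "(c1 * \<sigma>\<^sup>2 * (\<Sum>t<T. 1 / real (b * (t + 1))) + c2 * \<Delta> / \<eta>) / real T \<le> rate_bound K1 K2 (real T)"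
    if "1 \<le> T" for T
  proof -
    have "(\<Sum>t<T. 1 / real (b * (t + 1))) = (\<Sum>t<T. 1 / real (t + 1)) / real b"
      by (simp add: sum_divide_distrib algebra_simps)
    then have "c1 * \<sigma>\<^sup>2 * (\<Sum>t<T. 1 / real (b * (t + 1))) = K1 * (\<Sum>t<T. 1 / real (t + 1))"
      by (simp add: K1_def)
    also have "\<dots> \<le> K1 * (ln (real T) + 1)"
      using K_nonneg sum_inverse_le_ln[OF that] by (intro mult_left_mono)
    finally have "(c1 * \<sigma>\<^sup>2 * (\<Sum>t<T. 1 / real (b * (t + 1))) + K2) / real T \<le> (K1 * (ln (real T) + 1) + K2) / real T"
      by (intro divide_right_mono) auto
    then show ?thesis
      by (simp add: rate_bound_def K2_def add_divide_distrib distrib_left)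
  qed

  have "(\<integral>\<^sup>+\<omega>. (dist_zero (frechet_subdiff F (X (R \<omega>) \<omega>)))\<^sup>2 \<partial>M)
      \<le> ennreal (c1 * \<sigma>\<^sup>2 * (ln (real T) + 1) / (real b * real T) + c2 * \<Delta> / (\<eta> * real T))"
    if "1 \<le> T" and run: "mb_spg_run M D G r \<eta> (\<lambda>t. b * (t + 1)) x0 T X S R" for M :: "'w measure" and T X S R
  proof -
    interpret mb_spg_problem M D G r \<eta> "\<lambda>t. b * (t + 1)" x0 T X S R f gradf \<sigma> \<Delta> L c xstar
      by (rule problem[OF run])
    show ?thesis
      unfolding F rate
      using expected_dist_sq_le[OF that(1), unfolded C1_def C2_def, folded constants]
        ennreal_leI[OF sum_le[OF that(1)]]
      by (rule order_trans)
  qed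
  moreover have "(\<integral>\<^sup>+\<omega>. dist_zero (frechet_subdiff F (X (R \<omega>) \<omega>)) \<partial>M) \<le> ennreal \<epsilon>"
    if "0 < \<epsilon>" and run: "mb_spg_run M D G r \<eta> (\<lambda>t. b * (t + 1)) x0 (?N \<epsilon>) X S R" for \<epsilon> and M :: "'w measure" and X S R
  proof -
    interpret mb_spg_problem M D G r \<eta> "\<lambda>t. b * (t + 1)" x0 "?N \<epsilon>" X S R f gradf \<sigma> \<Delta> L c xstar
      by (rule problem[OF run])
    show ?thesis
      unfolding F
      by (rule expected_dist_le[OF N(1)[OF that(1)] that(1)], unfold C1_def C2_def, fold constants)
        (rule order_trans[OF sum_le[OF N(1)[OF that(1)]] N(2)[OF that(1)]])
  qed
  moreover have bigo: "(\<lambda>\<epsilon>. real (?N \<epsilon>)) \<in> O[at_right 0](\<lambda>\<epsilon>. 1 / \<epsilon>\<^sup>2 * ln (1 / \<epsilon>) ^ 2)"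
    unfolding N_eq by (rule rate_bound_inverse[OF K_nonneg])
  then have "(\<lambda>\<epsilon>. real (?N \<epsilon>)) \<in> soft_O (\<lambda>\<epsilon>. 1 / \<epsilon>\<^sup>2)"
    unfolding soft_O_def by blast
  moreover have "(\<lambda>\<epsilon>. real (\<Sum>t<?N \<epsilon>. b * (t + 1))) \<in> soft_O (\<lambda>\<epsilon>. 1 / \<epsilon> ^ 4)"
  proof -
    \<comment> \<open>The total number of samples is at most \<open>b\<close> times the square of
      the iteration count; squaring the order of that count raises the power of the logarithm from 2
      to 4.\<close>
    have "(\<lambda>\<epsilon>. real (\<Sum>t<?N \<epsilon>. b * (t + 1))) \<in> O[at_right 0](\<lambda>\<epsilon>. real (?N \<epsilon>) ^ 2)"
    proof (rule bigoI[of _ "real b"], rule always_eventually, rule allI)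
      fix \<epsilon>
      have "real (\<Sum>t<?N \<epsilon>. b * (t + 1)) \<le> real (b * (?N \<epsilon>)\<^sup>2)"
        using sum_batch_le by (rule of_nat_mono)
      then show "norm (real (\<Sum>t<?N \<epsilon>. b * (t + 1))) \<le> real b * norm (real (?N \<epsilon>) ^ 2)"
        by (simp del: of_nat_sum)
    qed
    also have "(\<lambda>\<epsilon>. real (?N \<epsilon>) ^ 2) \<in> O[at_right 0](\<lambda>\<epsilon>. (1 / \<epsilon>\<^sup>2 * ln (1 / \<epsilon>) ^ 2) ^ 2)"
      by (rule landau_o.big_power[OF bigo])
    also have "(\<lambda>\<epsilon>. (1 / \<epsilon>\<^sup>2 * ln (1 / \<epsilon>) ^ 2) ^ 2) = (\<lambda>\<epsilon>::real. 1 / \<epsilon> ^ 4 * ln (1 / \<epsilon>) ^ 4)"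
      by (simp add: power_mult_distrib power_divide flip: power_mult)
    finally show ?thesis
      unfolding soft_O_def by blast
  qed
  ultimately show ?thesis by blast
qed

end
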